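(* Fix the data $X=(x_1,\dots,x_n)'$, $Y=(y_1,\dots,y_n)$, the quantile levels $0<\tau_1<\cdots<\tau_m<1$, a constant $\sigma^2>0$ and a prior $\pi_m(\cdot|X)$ on $B_m=(\beta(\tau_1),\dots,\beta(\tau_m))$. The stationary distribution of the Markov chain $(B_m^k)_{k\ge 0}$ constructed by the linearly interpolated density (LID) Metropolis--Hastings algorithm described in the context is $$\hat p_m(B_m|X,Y)=\frac{\pi_m(B_m|X)\,\hat p_m(Y|X,B_m)}{\hat p_m(Y|X)},\qquad \hat p_m(Y|X)=\int \pi_m(B_m|X)\,\hat p_m(Y|X,B_m)\,dB_m .$$
   Context: Data: $x_i\in\mathbb R^p$ (with first component equal to $1$) and $y_i\in\mathbb R$, $i=1,\dots,n$. $B_m=(\beta(\tau_1),\dots,\beta(\tau_m))$ with $\beta(\tau_j)\in\mathbb R^p$; $x_i\beta(\tau_j)$ means $x_i^T\beta(\tau_j)$. The prior $\pi_m(\cdot|X)$ is a density supported on the set of $B_m$ satisfying $x_i\beta(\tau_1)<x_i\beta(\tau_2)<\cdots<x_i\beta(\tau_m)$ for all $i=1,\dots,n$ (for example, a normal density truncated to this set). Linearly interpolated density: for $B_m$ satisfying the monotonicity constraint $x_i\beta(\tau_1)<x_i\beta(\tau_2)<\cdots<x_i\beta(\tau_m)$ for all $i=1,\dots,n$, $$\hat f_i(y|x_i,B_m)=\sum_{j=1}^{m-1} I_{\{y\in(x_i\beta(\tau_j),\,x_i\beta(\tau_{j+1}))\}}\frac{\tau_{j+1}-\tau_j}{x_i\beta(\tau_{j+1})-x_i\beta(\tau_j)}+I_{\{y\in(-\infty,x_i\beta(\tau_1))\}}\tau_1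 f_1(y)+I_{\{y\in(x_i\beta(\tau_m),\infty)\}}(1-\tau_m)f_2(y),$$ where $f_1$ is the density of the left half of $N(x_i\beta(\tau_1),\sigma^2)$ (i.e. this normal distribution conditioned to lie below its mean) and $f_2$ is the density of the right half of $N(x_i\beta(\tau_m),\sigma^2)$ (conditioned to lie above its mean). The approximate likelihood is $\hat p_m(Y|X,B_m)=\prod_{i=1}^n \hat f_i(y_i|x_i,B_m)$. Algorithm (the Markov chain): start from some $B_m^0$ satisfying the monotonicity constraint $x_i\beta(\tau_1)<x_i\beta(\tau_2)<\cdots<x_i\beta(\tau_m)$ for all $i=1,\dots,n$. Given $B_m^{k-1}$, pick $j\in\{1,\dots,m\}$ uniformly at random and then a component index $\ell\in\{1,\dots,p\}$ uniformly at random. For each $i$ define a lower bound $a_i$ and an upper bound $b_i$ as follows, where $s_i=\sum_{t\ne \ell}x_{i,t}\beta_t^{k-1}(\tau_j)$, and with the conventions $x_i^T\beta^{k-1}(\tau_0)=-\infty$, $x_i^T\beta^{k-1}(\tau_{m+1})=+\infty$: if $x_{i,\ell}>0$, $a_i=(x_i^T\beta^{k-1}(\tau_{j-1})-s_i)/x_{i,\ell}$ and $b_i=(x_i^T\beta^{k-1}(\tau_{j+1})-s_i)/x_{i,\ell}$; if $x_{i,\ell}<0$, $a_i=(x_i^T\beta^{k-1}(\tau_{j+1})-s_i)/x_{i,\ell}$ and $b_i=(x_i^T\beta^{k-1}(\tau_{j-1})-s_i)/x_{i,\ell}$; if $x_{i,\ell}=0$, $a_i=-\infty$ and $b_i=+\infty$.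 Let $a=\max_i a_i$, $b=\min_i b_i$. Propose a new value for the $\ell$-th component of $\beta(\tau_j)$ from $\mathrm{Uniform}(a,b)$ if $a,b$ are both finite, and from a normal distribution truncated to $(a,b)$ otherwise; all other components are left unchanged, which gives the proposal $B_m^*$. With $q(B\to B')$ denoting the proposal transition density from $B$ to $B'$, set $B_m^k=B_m^*$ with probability $$r=\min\left(1,\frac{\pi_m(B_m^*|X)\,\hat p_m(Y|X,B_m^* )\,q(B_m^*\to B_m^{k-1})}{\pi_m(B_m^{k-1}|X)\,\hat p_m(Y|X,B_m^{k-1})\,q(B_m^{k-1}\to B_m^* )}\right),$$ and $B_m^k=B_m^{k-1}$ with probability $1-r$. *)

theory Defs
  imports "HOL-Probability.Probability"
begin

text \<open>
  A value of \<open>B = (\<beta>(\<tau>\<^sub>1), \<dots>, \<beta>(\<tau>\<^sub>m))\<close> is a function on index pairs: \<open>B (j, t)\<close> is the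
  \<open>t\<close>-th component of \<open>\<beta>(\<tau>\<^sub>j)\<close>, for \<open>1 \<le> j \<le> m\<close> and \<open>1 \<le> t \<le> p\<close>.  The data are \<open>x i t\<close>
  (the \<open>t\<close>-th component of \<open>x\<^sub>i\<close>) and \<open>y i\<close>, for \<open>1 \<le> i \<le> n\<close>.
\<close>

type_synonym coef = "nat \<times> nat \<Rightarrow> real"

definition coef_space :: "nat \<Rightarrow> nat \<Rightarrow> coef measure" where
  "coef_space p m = PiM ({1..m} \<times> {1..p}) (\<lambda>_. lborel)"

definition lin :: "nat \<Rightarrow> (nat \<Rightarrow> nat \<Rightarrow> real) \<Rightarrow> coef \<Rightarrow> nat \<Rightarrow> nat \<Rightarrow> real" where
  "lin p x B i j = (\<Sum>t = 1..p. x i t * B (j, t))"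

definition monotone_set :: "nat \<Rightarrow> nat \<Rightarrow> nat \<Rightarrow> (nat \<Rightarrow> nat \<Rightarrow> real) \<Rightarrow> coef set" where
  "monotone_set n p m x =
     {B \<in> space (coef_space p m). \<forall>i\<in>{1..n}. \<forall>j\<in>{1..<m}. lin p x B i j < lin p x B i (j + 1)}"

definition state_space :: "nat \<Rightarrow> nat \<Rightarrow> nat \<Rightarrow> (nat \<Rightarrow> nat \<Rightarrow> real) \<Rightarrow> coef measure" where
  "state_space n p m x = restrict_space (coef_space p m) (monotone_set n p m x)"

text \<open>Density of the normal distribution \<open>N(\<mu>, s\<^sup>2)\<close> conditioned to lie in \<open>A\<close>.\<close>

definition trunc_normal_density :: "real \<Rightarrow> real \<Rightarrow> real set \<Rightarrow> real \<Rightarrow> real" where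
  "trunc_normal_density \<mu> s A v =
     normal_density \<mu> s v * indicator A v / measure (density lborel (normal_density \<mu> s)) A"

definition lid_density ::
  "nat \<Rightarrow> nat \<Rightarrow> (nat \<Rightarrow> nat \<Rightarrow> real) \<Rightarrow> (nat \<Rightarrow> real) \<Rightarrow> real \<Rightarrow> coef \<Rightarrow> nat \<Rightarrow> real \<Rightarrow> real" where
  "lid_density p m x \<tau> \<sigma> B i v =
     (\<Sum>j = 1..<m. indicator {lin p x B i j <..< lin p x B i (j + 1)} v
                  * ((\<tau> (j + 1) - \<tau> j) / (lin p x B i (j + 1) - lin p x B i j)))
     + indicator {..< lin p x B i 1} v
         * (\<tau> 1 * trunc_normal_density (lin p x B i 1) \<sigma> {..< lin p x B i 1} v)
     + indicator {lin p x B i m <..} v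
         * ((1 - \<tau> m) * trunc_normal_density (lin p x B i m) \<sigma> {lin p x B i m <..} v)"

definition lid_likelihood ::
  "nat \<Rightarrow> nat \<Rightarrow> nat \<Rightarrow> (nat \<Rightarrow> nat \<Rightarrow> real) \<Rightarrow> (nat \<Rightarrow> real) \<Rightarrow> (nat \<Rightarrow> real) \<Rightarrow> real \<Rightarrow> coef \<Rightarrow> real" where
  "lid_likelihood n p m x y \<tau> \<sigma> B = (\<Prod>i = 1..n. lid_density p m x \<tau> \<sigma> B i (y i))"

definition evidence ::
  "nat \<Rightarrow> nat \<Rightarrow> nat \<Rightarrow> (nat \<Rightarrow> nat \<Rightarrow> real) \<Rightarrow> (nat \<Rightarrow> real) \<Rightarrow> (nat \<Rightarrow> real) \<Rightarrow> real
    \<Rightarrow> (coef \<Rightarrow> real) \<Rightarrow> real" where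
  "evidence n p m x y \<tau> \<sigma> prior =
     (\<integral>B. prior B * lid_likelihood n p m x y \<tau> \<sigma> B \<partial>coef_space p m)"

definition posterior ::
  "nat \<Rightarrow> nat \<Rightarrow> nat \<Rightarrow> (nat \<Rightarrow> nat \<Rightarrow> real) \<Rightarrow> (nat \<Rightarrow> real) \<Rightarrow> (nat \<Rightarrow> real) \<Rightarrow> real
    \<Rightarrow> (coef \<Rightarrow> real) \<Rightarrow> coef measure" where
  "posterior n p m x y \<tau> \<sigma> prior =
     density (state_space n p m x)
       (\<lambda>B. prior B * lid_likelihood n p m x y \<tau> \<sigma> B / evidence n p m x y \<tau> \<sigma> prior)"

definition ext_lin :: "nat \<Rightarrow> nat \<Rightarrow> (nat \<Rightarrow> nat \<Rightarrow> real) \<Rightarrow> coef \<Rightarrow> nat \<Rightarrow> nat \<Rightarrow> ereal" where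
  "ext_lin p m x B i j =
     (if j = 0 then -\<infinity> else if j = m + 1 then \<infinity> else ereal (lin p x B i j))"

definition lin_rest :: "nat \<Rightarrow> (nat \<Rightarrow> nat \<Rightarrow> real) \<Rightarrow> coef \<Rightarrow> nat \<Rightarrow> nat \<Rightarrow> nat \<Rightarrow> real" where
  "lin_rest p x B i j l = (\<Sum>t \<in> {1..p} - {l}. x i t * B (j, t))"

definition lower_i ::
  "nat \<Rightarrow> nat \<Rightarrow> (nat \<Rightarrow> nat \<Rightarrow> real) \<Rightarrow> coef \<Rightarrow> nat \<Rightarrow> nat \<Rightarrow> nat \<Rightarrow> ereal" where
  "lower_i p m x B j l i =
     (if x i l > 0 then (ext_lin p m x B i (j - 1) - ereal (lin_rest p x B i j l)) / ereal (x i l)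
      else if x i l < 0 then (ext_lin p m x B i (j + 1) - ereal (lin_rest p x B i j l)) / ereal (x i l)
      else -\<infinity>)"

definition upper_i ::
  "nat \<Rightarrow> nat \<Rightarrow> (nat \<Rightarrow> nat \<Rightarrow> real) \<Rightarrow> coef \<Rightarrow> nat \<Rightarrow> nat \<Rightarrow> nat \<Rightarrow> ereal" where
  "upper_i p m x B j l i =
     (if x i l > 0 then (ext_lin p m x B i (j + 1) - ereal (lin_rest p x B i j l)) / ereal (x i l)
      else if x i l < 0 then (ext_lin p m x B i (j - 1) - ereal (lin_rest p x B i j l)) / ereal (x i l)
      else \<infinity>)"

definition lower :: "nat \<Rightarrow> nat \<Rightarrow> nat \<Rightarrow> (nat \<Rightarrow> nat \<Rightarrow> real) \<Rightarrow> coef \<Rightarrow> nat \<Rightarrow> nat \<Rightarrow> ereal" where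
  "lower n p m x B j l = Max (lower_i p m x B j l ` {1..n})"

definition upper :: "nat \<Rightarrow> nat \<Rightarrow> nat \<Rightarrow> (nat \<Rightarrow> nat \<Rightarrow> real) \<Rightarrow> coef \<Rightarrow> nat \<Rightarrow> nat \<Rightarrow> ereal" where
  "upper n p m x B j l = Min (upper_i p m x B j l ` {1..n})"

text \<open>
  Density of the proposed new value \<open>v\<close> of the component \<open>(j, l)\<close>.  The algorithm does not specify
  the parameters of the normal distribution that is truncated; its mean \<open>loc j l B\<close> and standard
  deviation \<open>spread j l B\<close> may depend on the selected component and on the current state.
\<close>

definition value_density ::
  "nat \<Rightarrow> nat \<Rightarrow> nat \<Rightarrow> (nat \<Rightarrow> nat \<Rightarrow> real) \<Rightarrow> (nat \<Rightarrow> nat \<Rightarrow> coef \<Rightarrow> real)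
    \<Rightarrow> (nat \<Rightarrow> nat \<Rightarrow> coef \<Rightarrow> real) \<Rightarrow> nat \<Rightarrow> nat \<Rightarrow> coef \<Rightarrow> real \<Rightarrow> real" where
  "value_density n p m x loc spread j l B v =
     (let a = lower n p m x B j l; b = upper n p m x B j l; I = {u. a < ereal u \<and> ereal u < b}
      in if \<bar>a\<bar> \<noteq> \<infinity> \<and> \<bar>b\<bar> \<noteq> \<infinity>
         then indicator I v / (real_of_ereal b - real_of_ereal a)
         else trunc_normal_density (loc j l B) (spread j l B) I v)"

text \<open>
  The transition density \<open>q(B \<rightarrow> B')\<close> of the proposal, where \<open>B'\<close> differs from \<open>B\<close> at most in the
  component \<open>(j, l)\<close>: the probability of selecting \<open>(j, l)\<close> times the density of the new value.
\<close>

definition proposal_density ::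
  "nat \<Rightarrow> nat \<Rightarrow> nat \<Rightarrow> (nat \<Rightarrow> nat \<Rightarrow> real) \<Rightarrow> (nat \<Rightarrow> nat \<Rightarrow> coef \<Rightarrow> real)
    \<Rightarrow> (nat \<Rightarrow> nat \<Rightarrow> coef \<Rightarrow> real) \<Rightarrow> nat \<Rightarrow> nat \<Rightarrow> coef \<Rightarrow> coef \<Rightarrow> real" where
  "proposal_density n p m x loc spread j l B B' =
     1 / real m * (1 / real p) * value_density n p m x loc spread j l B (B' (j, l))"

text \<open>
  The ratio in the acceptance probability is undefined when its denominator vanishes; as usual for
  the Metropolis-Hastings algorithm the proposal is then accepted.  For a positive prior this
  concerns, apart from values \<open>B' (j, l)\<close> that are proposed with probability zero, only the states
  in which some \<open>y i\<close> equals some \<open>lin p x B i j\<close>.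
\<close>

definition accept_prob ::
  "nat \<Rightarrow> nat \<Rightarrow> nat \<Rightarrow> (nat \<Rightarrow> nat \<Rightarrow> real) \<Rightarrow> (nat \<Rightarrow> real) \<Rightarrow> (nat \<Rightarrow> real) \<Rightarrow> real
    \<Rightarrow> (coef \<Rightarrow> real) \<Rightarrow> (nat \<Rightarrow> nat \<Rightarrow> coef \<Rightarrow> real) \<Rightarrow> (nat \<Rightarrow> nat \<Rightarrow> coef \<Rightarrow> real)
    \<Rightarrow> nat \<Rightarrow> nat \<Rightarrow> coef \<Rightarrow> coef \<Rightarrow> real" where
  "accept_prob n p m x y \<tau> \<sigma> prior loc spread j l B B' =
     (let num = prior B' * lid_likelihood n p m x y \<tau> \<sigma> B'
                  * proposal_density n p m x loc spread j l B' B;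
          den = prior B * lid_likelihood n p m x y \<tau> \<sigma> B
                  * proposal_density n p m x loc spread j l B B'
      in if den = 0 then 1 else min 1 (num / den))"

text \<open>
  Law of the next state given the current state \<open>B\<close>.  The iteration is carried out in
  \<open>coef_space p m\<close>; from a state in \<open>monotone_set n p m x\<close> the proposal stays in that set almost
  surely, so that the law restricts to a probability measure on \<open>state_space n p m x\<close>.
\<close>

definition lid_kernel ::
  "nat \<Rightarrow> nat \<Rightarrow> nat \<Rightarrow> (nat \<Rightarrow> nat \<Rightarrow> real) \<Rightarrow> (nat \<Rightarrow> real) \<Rightarrow> (nat \<Rightarrow> real) \<Rightarrow> real
    \<Rightarrow> (coef \<Rightarrow> real) \<Rightarrow> (nat \<Rightarrow> nat \<Rightarrow> coef \<Rightarrow> real) \<Rightarrow> (nat \<Rightarrow> nat \<Rightarrow> coef \<Rightarrow> real)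
    \<Rightarrow> coef \<Rightarrow> coef measure" where
  "lid_kernel n p m x y \<tau> \<sigma> prior loc spread B =
     restrict_space
       (do {
          j \<leftarrow> uniform_count_measure {1..m};
          l \<leftarrow> uniform_count_measure {1..p};
          v \<leftarrow> density lborel (value_density n p m x loc spread j l B);
          let B' = B((j, l) := v);
          acc \<leftarrow> measure_pmf (bernoulli_pmf (accept_prob n p m x y \<tau> \<sigma> prior loc spread j l B B'));
          return (coef_space p m) (if acc then B' else B)
        })
       (monotone_set n p m x)"

definition stationary_distribution ::
  "'a measure \<Rightarrow> ('a \<Rightarrow> 'a measure) \<Rightarrow> 'a measure \<Rightarrow> bool" where
  "stationary_distribution M K N \<longleftrightarrow>
     K \<in> M \<rightarrow>\<^sub>M prob_algebra M \<and> N \<in> space (prob_algebra M) \<and> N \<bind> K = N"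

end

theory Submission
  imports Defs
begin

text \<open>
  Stationarity is detailed balance for each single-coordinate update: Fubini's theorem lets the old
  and the new value of the selected coordinate change roles.

  For uniqueness, let \<open>N \<noteq> P\<close> be stationary with densities \<open>f, g\<close> with respect to a common measure.
  The sets \<open>{f > g}\<close> and \<open>{f < g}\<close> are almost surely never left, hence contain disjoint nonempty
  absorbing sets. But a nonempty absorbing set \<open>A\<close> is conull: for a positive prior almost every
  single-coordinate move inside the constraint set stays in \<open>A\<close>, and such moves lead from any state
  to almost every other one. One first raises the intercepts, the one of \<open>\<tau>\<^sub>m\<close> first, so far that the
  planes \<open>x\<^sub>i\<beta>(\<tau>\<^sub>j)\<close> are hugely separated, then sets all slopes to their target values, and finally
  lowers the intercepts to theirs, the one of \<open>\<tau>\<^sub>1\<close> first.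
\<close>

text \<open>A competing stationary distribution need not have a Lebesgue density: a rejected
  proposal leaves the state where it is, so a stationary law might a priori charge null sets such as
  the states of zero likelihood. Hence the reference measure for uniqueness is the mixture of the
  two laws themselves, and the absorbing sets found are only known to be nonempty. This is why
  irreducibility has to hold from every single state, not from almost every one. Absorption gives
  little in another respect: for each coordinate almost every admissible value keeps the chain in
  the set, but no particular value can be prescribed. The path is therefore followed towards a
  random target, and Fubini's theorem collects the exceptional values of all its steps in a null
  set. The detour over separated planes is forced by the shape of the constraint set: replacing the
  coordinates of one of its points by those of another, one at a time, may leave it on the
  way.\<close>

section \<open>Uniqueness of stationary distributions\<close>

text \<open>The integral of \<open>h B * measure (K B) E\<close> is at most that of the positive
  part of \<open>h\<close>. For \<open>E = {h > 0}\<close> invariance makes the two equal, so almost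
  every state with \<open>h B > 0\<close> moves into \<open>E\<close> with probability 1. Discarding
  the exceptional states again and again turns "almost every" into "every".\<close>

lemma absorbing_subset:
  fixes h :: "'a \<Rightarrow> real"
  assumes K: "K \<in> M \<rightarrow>\<^sub>M prob_algebra M" and Q: "finite_measure Q" "sets Q = sets M"
    and h: "integrable Q h"
    and inv: "\<And>E. E \<in> sets M \<Longrightarrow>
      (\<integral>B. h B * measure (K B) E \<partial>Q) = (\<integral>B. h B * indicator E B \<partial>Q)"
    and pos: "\<not> (AE B in Q. h B \<le> 0)"
  obtains A where "A \<in> sets M" "A \<noteq> {}" "\<And>B. B \<in> A \<Longrightarrow> h B > 0"
    "\<And>B. B \<in> A \<Longrightarrow> measure (K B) A = 1"
proof -
  interpret Q: finite_measure Q by fact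
  have prob: "prob_space (K B)" and sets_K: "sets (K B) = sets M" if "B \<in> space M" for B
    using measurable_space[OF K that] by (auto simp: space_prob_algebra)
  have space_Q: "space Q = space M"
    using Q(2) by (rule sets_eq_imp_space_eq)
  have K_meas: "(\<lambda>B. measure (K B) E) \<in> borel_measurable M" if "E \<in> sets M" for E
    using measurable_compose[OF measurable_prob_algebraD[OF K] measurable_measure_subprob_algebra[OF that]] .
  have K_meas_Q: "(\<lambda>B. measure (K B) E) \<in> borel_measurable Q" if "E \<in> sets M" for E
    using K_meas[OF that] by (simp add: measurable_cong_sets[OF Q(2) refl])
  have [measurable]: "h \<in> borel_measurable Q" using h by simp
  define Y where "Y = {B \<in> space M. h B > 0}"
  have Y_Q: "Y \<in> sets Q"
    unfolding Y_def space_Q[symmetric] by measurable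
  then have Y: "Y \<in> sets M" using Q(2) by simp
  have bounded: "integrable Q (\<lambda>B. h B * c B)"
    if "c \<in> borel_measurable Q" "\<And>B. B \<in> space M \<Longrightarrow> 0 \<le> c B \<and> c B \<le> 1" for c
    by (rule Bochner_Integration.integrable_bound[OF h])
      (use that in \<open>auto intro!: AE_I2 simp: abs_mult space_Q mult_left_le\<close>)
  have measure_le_1: "measure (K B) E \<le> 1" if "B \<in> space M" for B E
    using prob_space.prob_le_1[OF prob[OF that]] .
  have full: "AE B in Q. B \<in> Y \<longrightarrow> measure (K B) E = 1"
    if E: "E \<in> sets M" "E \<subseteq> Y" "AE B in Q. B \<in> Y \<longrightarrow> B \<in> E" for E
  proof -
    \<comment> \<open>On \<open>Y\<close> this is \<open>h B * (1 - measure (K B) E)\<close>; off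
      \<open>Y\<close> it is \<open>- h B * measure (K B) E\<close> with \<open>h B \<le> 0\<close>.
      So it is nonnegative everywhere, and invariance gives it integral 0.\<close>
    let ?g = "\<lambda>B. h B * indicator Y B - h B * measure (K B) E"
    have int: "integrable Q (\<lambda>B. h B * indicator Y B)" "integrable Q (\<lambda>B. h B * measure (K B) E)"
      using Y_Q K_meas_Q[OF E(1)] by (auto intro!: bounded measure_le_1 split: split_indicator)
    have "(\<integral>B. h B * indicator Y B \<partial>Q) = (\<integral>B. h B * indicator E B \<partial>Q)"
      using E Y_Q Q(2) by (intro integral_cong_AE) (auto split: split_indicator)
    then have "(\<integral>B. ?g B \<partial>Q) = 0"
      using int inv[OF E(1)] by simp
    moreover have "AE B in Q. 0 \<le> ?g B"
      using measure_le_1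
      by (intro AE_I2) (auto simp: Y_def space_Q mult_left_le mult_nonpos_nonneg split: split_indicator)
    ultimately have "AE B in Q. ?g B = 0"
      using int by (subst integral_nonneg_eq_0_iff_AE[symmetric]) auto
    then show ?thesis
      by eventually_elim (auto simp: Y_def split: split_indicator_asm)
  qed
  \<comment> \<open>Removing the states that may leave \<open>Y\<close> can create new ones that may
    leave the smaller set, so the removal is iterated. Each stage differs from \<open>Y\<close> by a
    null set only, which is what \<open>full\<close> needs to apply again; in the intersection the
    process has come to rest.\<close>
  define A where "A = rec_nat Y (\<lambda>_ A. {B \<in> A. measure (K B) A = 1})"
  have A_0: "A 0 = Y" and A_Suc: "A (Suc k) = {B \<in> A k. measure (K B) (A k) = 1}" for k
    by (simp_all add: A_def)
  have A: "A k \<in> sets M \<and> A k \<subseteq> Y \<and> (AE B in Q. B \<in> Y \<longrightarrow> B \<in> A k)" for k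
  proof (induction k)
    case 0
    then show ?case using Y by (simp add: A_0)
  next
    case (Suc k)
    then have Ak: "A k \<in> sets M" and "A k \<subseteq> Y" and AE: "AE B in Q. B \<in> Y \<longrightarrow> B \<in> A k" by auto
    have "A (Suc k) = A k \<inter> {B \<in> space M. measure (K B) (A k) = 1}"
      using sets.sets_into_space[OF Ak] by (auto simp: A_Suc)
    also have "\<dots> \<in> sets M"
      using Ak K_meas[OF Ak] by measurable
    finally have "A (Suc k) \<in> sets M" .
    moreover have "AE B in Q. B \<in> Y \<longrightarrow> B \<in> A (Suc k)"
      using full[OF Ak \<open>A k \<subseteq> Y\<close> AE] AE by eventually_elim (auto simp: A_Suc)
    ultimately show ?case using \<open>A k \<subseteq> Y\<close> by (auto simp: A_Suc)
  qed
  show ?thesis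
  proof (rule that[of "\<Inter>k. A k"])
    show Inter: "(\<Inter>k. A k) \<in> sets M" using A by auto
    show "h B > 0" if "B \<in> (\<Inter>k. A k)" for B
      using that A_0 by (auto simp: Y_def)
    have "AE B in Q. \<forall>k. B \<in> Y \<longrightarrow> B \<in> A k"
      using A by (subst AE_all_countable) auto
    then have "AE B in Q. h B \<le> 0" if "(\<Inter>k. A k) = {}"
      using AE_space by eventually_elim (use that in \<open>force simp: Y_def space_Q\<close>)
    then show "(\<Inter>k. A k) \<noteq> {}" using pos by blast
    show "measure (K B) (\<Inter>k. A k) = 1" if "B \<in> (\<Inter>k. A k)" for B
    proof -
      have B: "B \<in> space M" using that Inter sets.sets_into_space by blast
      interpret prob_space "K B" using prob[OF B] .
      have "AE B' in K B. B' \<in> A k" for k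
        using that A[of k] A_Suc[of k] sets_K[OF B] by (subst AE_in_set_eq_1) auto
      then have "AE B' in K B. B' \<in> (\<Inter>k. A k)"
        by (simp add: AE_all_countable)
      then show ?thesis
        using Inter sets_K[OF B] by (subst (asm) AE_in_set_eq_1) auto
    qed
  qed
qed

text \<open>The hypothesis \<open>meet\<close> is a form of irreducibility that refers to no
  reference measure. It is contradicted by two absorbing sets, one where the difference
  \<open>h\<close> of the densities is positive and one where it is negative.\<close>

lemma stationary_distribution_unique:
  assumes N: "stationary_distribution M K N" and P: "stationary_distribution M K P"
    and meet: "\<And>A A'. \<lbrakk>A \<in> sets M; A' \<in> sets M; A \<noteq> {}; A' \<noteq> {};
      \<And>B. B \<in> A \<Longrightarrow> measure (K B) A = 1; \<And>B. B \<in> A' \<Longrightarrow> measure (K B) A' = 1\<rbrakk> \<Longrightarrow> A \<inter> A' \<noteq> {}"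
  shows "N = P"
proof (rule ccontr)
  assume "N \<noteq> P"
  have K: "K \<in> M \<rightarrow>\<^sub>M prob_algebra M"
    and N': "prob_space N" "sets N = sets M" "N \<bind> K = N"
    and P': "prob_space P" "sets P = sets M" "P \<bind> K = P"
    using N P by (auto simp: stationary_distribution_def space_prob_algebra)
  have sub: "K \<in> M \<rightarrow>\<^sub>M subprob_algebra M" using K by (rule measurable_prob_algebraD)
  have NP_sub: "N \<in> space (subprob_algebra M)" "P \<in> space (subprob_algebra M)"
    using N' P' by (auto simp: space_subprob_algebra prob_space_imp_subprob_space)
  \<comment> \<open>The mixture with weights 1/2 dominates both laws, so both have Radon-Nikodym
    densities, whatever \<open>N\<close> and \<open>P\<close> look like.\<close>
  define Q where "Q = measure_pmf (bernoulli_pmf (1/2)) \<bind> (\<lambda>b. if b then N else P)"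
  have kern: "(\<lambda>b. if b then N else P) \<in> measure_pmf (bernoulli_pmf (1/2)) \<rightarrow>\<^sub>M subprob_algebra M"
    using NP_sub by auto
  have sets_Q: "sets Q = sets M"
    unfolding Q_def by (subst sets_bind) (use N' P' in auto)
  have emeasure_Q: "emeasure Q E = emeasure N E * ennreal (1/2) + emeasure P E * ennreal (1/2)"
    if "E \<in> sets M" for E
    unfolding Q_def using that by (subst emeasure_bind[OF _ kern]) auto
  have "prob_space Q"
    unfolding Q_def using N' P' by (intro measure_pmf.prob_space_bind[OF _ kern]) auto
  then have Q: "finite_measure Q" by (rule prob_space.finite_measure)
  interpret Q: finite_measure Q by fact
  have RN: "\<exists>f. integrable Q f \<and> R = density Q (\<lambda>B. ennreal (f B)) \<and> (\<forall>E\<in>sets M.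
      (\<integral>B. f B * measure (K B) E \<partial>Q) = measure R E \<and> (\<integral>B. f B * indicator E B \<partial>Q) = measure R E)"
    if R: "prob_space R" "sets R = sets M" "R \<bind> K = R" and le: "\<And>E. E \<in> sets M \<Longrightarrow> emeasure Q E = 0 \<Longrightarrow> emeasure R E = 0"
    for R
  proof -
    interpret R: prob_space R by fact
    have ac: "absolutely_continuous Q R"
      using le R(2) sets_Q by (auto simp: absolutely_continuous_def null_sets_def)
    have sets_RQ: "sets R = sets Q" using R(2) sets_Q by simp
    obtain f where f: "f \<in> borel_measurable Q" "AE B in Q. RN_deriv Q R B = ennreal (f B)" "\<And>B. 0 \<le> f B"
      by (rule Q.real_RN_deriv[OF R.finite_measure_axioms ac sets_RQ]) (rule that)
    have "density Q (RN_deriv Q R) = R"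
      using Q.density_RN_deriv[OF ac] R(2) sets_Q by simp
    moreover have "density Q (RN_deriv Q R) = density Q (\<lambda>B. ennreal (f B))"
      using f by (intro density_cong) auto
    ultimately have R_eq: "R = density Q (\<lambda>B. ennreal (f B))" by simp
    have "(\<integral>\<^sup>+B. ennreal (f B) \<partial>Q) = emeasure R (space R)"
      using f(1) by (simp add: R_eq emeasure_density cong: nn_integral_cong)
    then have "integrable Q f"
      using f by (intro integrableI_nonneg) (auto simp: R.emeasure_space_1)
    moreover have "(\<integral>B. f B * measure (K B) E \<partial>Q) = measure R E" if E: "E \<in> sets M" for E
    proof -
      have [measurable]: "(\<lambda>B. measure (K B) E) \<in> borel_measurable Q"
        using measurable_compose[OF sub measurable_measure_subprob_algebra[OF E]]
        by (simp add: measurable_cong_sets[OF sets_Q refl])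
      have "(\<integral>B. f B * measure (K B) E \<partial>Q) = (\<integral>B. measure (K B) E \<partial>R)"
        unfolding R_eq using f by (subst integral_density) auto
      also have "\<dots> = measure (R \<bind> K) E"
        using sub E R(2) by (subst R.measure_bind[where N = M]) (auto simp: measurable_cong_sets[OF R(2) refl])
      finally show ?thesis using R(3) by simp
    qed
    moreover have "(\<integral>B. f B * indicator E B \<partial>Q) = measure R E" if E: "E \<in> sets M" for E
    proof -
      have "(\<integral>B. f B * indicator E B \<partial>Q) = (\<integral>B. indicator E B \<partial>R)"
        unfolding R_eq using f E sets_Q by (subst integral_density) auto
      then show ?thesis using E R(2) by simp
    qed
    ultimately show ?thesis using R_eq by blast
  qed
  obtain f where f: "integrable Q f" "N = density Q (\<lambda>B. ennreal (f B))"
    and f_int: "\<And>E. E \<in> sets M \<Longrightarrow> (\<integral>B. f B * measure (K B) E \<partial>Q) = measure N E"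
      "\<And>E. E \<in> sets M \<Longrightarrow> (\<integral>B. f B * indicator E B \<partial>Q) = measure N E"
    using RN[OF N'] emeasure_Q by (auto simp: add_eq_0_iff_both_eq_0)
  obtain g where g: "integrable Q g" "P = density Q (\<lambda>B. ennreal (g B))"
    and g_int: "\<And>E. E \<in> sets M \<Longrightarrow> (\<integral>B. g B * measure (K B) E \<partial>Q) = measure P E"
      "\<And>E. E \<in> sets M \<Longrightarrow> (\<integral>B. g B * indicator E B \<partial>Q) = measure P E"
    using RN[OF P'] emeasure_Q by (auto simp: add_eq_0_iff_both_eq_0)
  have bounded: "integrable Q (\<lambda>B. k B * c B)" if "integrable Q k"
    "c \<in> borel_measurable M" "\<And>B. B \<in> space M \<Longrightarrow> 0 \<le> c B \<and> c B \<le> 1" for k c :: "'a \<Rightarrow> real"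
    by (rule Bochner_Integration.integrable_bound[OF that(1)])
      (use that in \<open>auto intro!: AE_I2 simp: abs_mult sets_eq_imp_space_eq[OF sets_Q] mult_left_le
        measurable_cong_sets[OF sets_Q refl]\<close>)
  have K_le_1: "measure (K B) E \<le> 1" if "B \<in> space M" for B E
    using measurable_space[OF K that] by (auto simp: space_prob_algebra intro: prob_space.prob_le_1)
  define h where "h = (\<lambda>B. f B - g B)"
  have h: "integrable Q h" unfolding h_def using f g by simp
  have h_int: "(\<integral>B. h B * measure (K B) E \<partial>Q) = measure N E - measure P E"
      "(\<integral>B. h B * indicator E B \<partial>Q) = measure N E - measure P E" if E: "E \<in> sets M" for E
  proof -
    have KE: "(\<lambda>B. measure (K B) E) \<in> borel_measurable M"
      using measurable_compose[OF sub measurable_measure_subprob_algebra[OF E]] .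
    show "(\<integral>B. h B * measure (K B) E \<partial>Q) = measure N E - measure P E"
      using bounded[OF f(1) KE] bounded[OF g(1) KE] f_int(1)[OF E] g_int(1)[OF E] K_le_1
      by (simp add: h_def left_diff_distrib)
    have IE: "(indicator E :: 'a \<Rightarrow> real) \<in> borel_measurable M" using E by simp
    show "(\<integral>B. h B * indicator E B \<partial>Q) = measure N E - measure P E"
      using bounded[OF f(1) IE] bounded[OF g(1) IE] f_int(2)[OF E] g_int(2)[OF E]
      by (simp add: h_def left_diff_distrib)
  qed
  have "measure N (space M) = 1" "measure P (space M) = 1"
    using prob_space.prob_space[OF N'(1)] prob_space.prob_space[OF P'(1)]
    by (simp_all add: sets_eq_imp_space_eq[OF N'(2)] sets_eq_imp_space_eq[OF P'(2)])
  then have "(\<integral>B. h B * indicator (space M) B \<partial>Q) = 0" using h_int(2)[of "space M"] by simp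
  then have h_0: "(\<integral>B. h B \<partial>Q) = 0"
    by (simp add: sets_eq_imp_space_eq[OF sets_Q, symmetric] cong: Bochner_Integration.integral_cong)
  have eq: "N = P" if "AE B in Q. h B = 0"
  proof -
    have "AE B in Q. ennreal (f B) = ennreal (g B)"
      using that by eventually_elim (simp add: h_def)
    then show "N = P" unfolding f(2) g(2) using f(1) g(1) by (intro density_cong) auto
  qed
  \<comment> \<open>Both laws have total mass 1, so \<open>h\<close> has integral 0; a function of
    one sign with integral 0 vanishes almost everywhere, which would give
    \<open>N = P\<close>.\<close>
  have pos: "\<not> (AE B in Q. h B \<le> 0)"
  proof
    assume "AE B in Q. h B \<le> 0"
    then have "AE B in Q. - h B = 0"
      using h h_0 by (subst integral_nonneg_eq_0_iff_AE[symmetric]) auto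
    then show False using eq \<open>N \<noteq> P\<close> by simp
  qed
  have neg: "\<not> (AE B in Q. - h B \<le> 0)"
  proof
    assume "AE B in Q. - h B \<le> 0"
    then have "AE B in Q. h B = 0"
      using h h_0 by (subst integral_nonneg_eq_0_iff_AE[symmetric]) auto
    then show False using eq \<open>N \<noteq> P\<close> by simp
  qed
  obtain A where A: "A \<in> sets M" "A \<noteq> {}" "\<And>B. B \<in> A \<Longrightarrow> h B > 0" "\<And>B. B \<in> A \<Longrightarrow> measure (K B) A = 1"
    by (rule absorbing_subset[OF K Q sets_Q h _ pos]) (simp_all add: h_int)
  obtain A' where A': "A' \<in> sets M" "A' \<noteq> {}" "\<And>B. B \<in> A' \<Longrightarrow> - h B > 0" "\<And>B. B \<in> A' \<Longrightarrow> measure (K B) A' = 1"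
    by (rule absorbing_subset[OF K Q sets_Q integrable_minus[OF h] _ neg]) (simp_all add: h_int)
  have "A \<inter> A' \<noteq> {}" using A A' by (intro meet)
  then obtain B where "B \<in> A" "B \<in> A'" by blast
  then show False using A(3)[of B] A'(3)[of B] by simp
qed

section \<open>Products of measures and truncated normal densities\<close>

text \<open>With the other coordinates \<open>r\<close> fixed, the old value \<open>u\<close> and
  the new value \<open>v\<close> are both integrated against \<open>M c\<close>, so the claim is
  Fubini's theorem in \<open>(u, v)\<close>. In terms of the chain it exchanges state and
  proposal.\<close>

lemma (in product_sigma_finite) nn_integral_fun_upd_swap:
  assumes I: "finite I" "c \<in> I"
    and G: "case_prod G \<in> borel_measurable (PiM I M \<Otimes>\<^sub>M PiM I M)"
  shows "(\<integral>\<^sup>+f. \<integral>\<^sup>+v. G f (f(c := v)) \<partial>M c \<partial>PiM I M) = (\<integral>\<^sup>+f. \<integral>\<^sup>+v. G (f(c := v)) f \<partial>M c \<partial>PiM I M)"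
proof -
  define J where "J = I - {c}"
  have J: "finite J" "c \<notin> J" and I_eq: "I = insert c J" using I by (auto simp: J_def)
  interpret c: sigma_finite_measure "M c" by (rule sigma_finite_measures)
  have upd[measurable]: "(\<lambda>(f, v). f(c := v)) \<in> PiM I M \<Otimes>\<^sub>M M c \<rightarrow>\<^sub>M PiM I M"
    using measurable_add_dim[of c I M] I(2) by (simp add: insert_absorb)
  note G[measurable]
  have "(\<lambda>(f, v). G f (f(c := v))) \<in> borel_measurable (PiM I M \<Otimes>\<^sub>M M c)"
    "(\<lambda>(f, v). G (f(c := v)) f) \<in> borel_measurable (PiM I M \<Otimes>\<^sub>M M c)" by measurable
  then have meas: "(\<lambda>f. \<integral>\<^sup>+v. G f (f(c := v)) \<partial>M c) \<in> borel_measurable (PiM I M)"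
    "(\<lambda>f. \<integral>\<^sup>+v. G (f(c := v)) f \<partial>M c) \<in> borel_measurable (PiM I M)"
    by measurable
  have "(\<integral>\<^sup>+f. \<integral>\<^sup>+v. G f (f(c := v)) \<partial>M c \<partial>PiM I M)
    = (\<integral>\<^sup>+r. \<integral>\<^sup>+u. \<integral>\<^sup>+v. G (r(c := u)) (r(c := v)) \<partial>M c \<partial>M c \<partial>PiM J M)"
    using meas(1) unfolding I_eq by (subst product_nn_integral_insert[OF J]) simp_all
  also have "\<dots> = (\<integral>\<^sup>+r. \<integral>\<^sup>+v. \<integral>\<^sup>+u. G (r(c := u)) (r(c := v)) \<partial>M c \<partial>M c \<partial>PiM J M)"
  proof (rule nn_integral_cong, rule pair_sigma_finite.Fubini')
    fix r assume r: "r \<in> space (PiM J M)"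
    have [measurable]: "(\<lambda>u. r(c := u)) \<in> M c \<rightarrow>\<^sub>M PiM I M"
      unfolding I_eq using r by measurable
    show "(\<lambda>(v, u). G (r(c := u)) (r(c := v))) \<in> borel_measurable (M c \<Otimes>\<^sub>M M c)"
      by measurable
  qed (simp add: pair_sigma_finite_def sigma_finite_measures)
  also have "\<dots> = (\<integral>\<^sup>+f. \<integral>\<^sup>+v. G (f(c := v)) f \<partial>M c \<partial>PiM I M)"
    using meas(2) unfolding I_eq by (subst product_nn_integral_insert[OF J]) simp_all
  finally show ?thesis .
qed

text \<open>All slices of the exceptional set in direction \<open>c\<close> are null, hence so is
  the set. Since \<open>f(c := v)\<close> ignores the old value at \<open>c\<close>, slices can be
  indexed by full points \<open>f\<close>, which spares users the splitting of the product.\<close>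

lemma (in product_sigma_finite) AE_PiM_fun_upd:
  assumes I: "finite I" "c \<in> I" and Q: "{f \<in> space (PiM I M). Q f} \<in> sets (PiM I M)"
    and AE: "\<And>f. f \<in> space (PiM I M) \<Longrightarrow> AE v in M c. Q (f(c := v))"
  shows "AE f in PiM I M. Q f"
proof -
  define J where "J = I - {c}"
  have J: "finite J" "c \<notin> J" and I_eq: "I = insert c J" using I by (auto simp: J_def)
  interpret c: sigma_finite_measure "M c" by (rule sigma_finite_measures)
  define E where "E = {f \<in> space (PiM I M). \<not> Q f}"
  have "E = space (PiM I M) - {f \<in> space (PiM I M). Q f}" by (auto simp: E_def)
  then have E: "E \<in> sets (PiM I M)" using Q by auto
  have "emeasure (PiM I M) E = (\<integral>\<^sup>+r. \<integral>\<^sup>+v. indicator E (r(c := v)) \<partial>M c \<partial>PiM J M)"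
    using E unfolding I_eq by (subst product_nn_integral_insert[OF J, symmetric]) auto
  also have "\<dots> = (\<integral>\<^sup>+r. 0 \<partial>PiM J M)"
  proof (intro nn_integral_cong)
    fix r assume r: "r \<in> space (PiM J M)"
    have [measurable]: "(\<lambda>u. r(c := u)) \<in> M c \<rightarrow>\<^sub>M PiM I M"
      unfolding I_eq using r by measurable
    have "AE v in M c. Q (r(c := v))"
    \<comment> \<open>The hypothesis speaks of full points; \<open>r\<close> extends to one only if
      \<open>M c\<close> has a point. Otherwise there is no \<open>v\<close> to consider.\<close>
    proof (cases "space (M c) = {}")
      case False
      then obtain u where "u \<in> space (M c)" by blast
      then have "r(c := u) \<in> space (PiM I M)"
        using r by (auto simp: I_eq space_PiM PiE_iff extensional_def)
      from AE[OF this] show ?thesis by simp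
    qed (auto intro: AE_I2)
    then have "AE v in M c. indicator E (r(c := v)) = (0::ennreal)"
      by eventually_elim (auto simp: E_def)
    then show "(\<integral>\<^sup>+v. indicator E (r(c := v)) \<partial>M c) = 0"
      using E by (subst nn_integral_0_iff_AE) auto
  qed
  finally have "E \<in> null_sets (PiM I M)" using E by auto
  then show ?thesis
    by (rule AE_I') (auto simp: E_def)
qed

section \<open>Normal distributions conditioned on open sets\<close>

lemma emeasure_lborel_open_pos:
  fixes A :: "real set"
  assumes "open A" "A \<noteq> {}"
  shows "emeasure lborel A > 0"
proof -
  obtain a e where a: "e > 0" "ball a e \<subseteq> A"
    using assms by (meson ex_in_conv open_contains_ball)
  have "0 < emeasure lborel {a - e<..<a + e}" using a(1) by simp
  also have "\<dots> \<le> emeasure lborel A"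
    using a assms by (intro emeasure_mono) (auto simp: ball_eq_greaterThanLessThan)
  finally show ?thesis .
qed

text \<open>The density is positive everywhere, so normal null sets are Lebesgue null. This keeps
  the normalising constant of a truncated normal density away from 0.\<close>

lemma measure_normal_open_pos:
  fixes A :: "real set"
  assumes "s > 0" "open A" "A \<noteq> {}"
  shows "measure (density lborel (normal_density \<mu> s)) A > 0"
proof -
  interpret prob_space "density lborel (normal_density \<mu> s)"
    using assms(1) by (rule prob_space_normal_density)
  have "emeasure (density lborel (normal_density \<mu> s)) A \<noteq> 0"
  proof
    have pos: "\<not> normal_density \<mu> s v \<le> 0" for v
      using normal_density_pos[OF assms(1), of \<mu> v] by simp
    assume "emeasure (density lborel (normal_density \<mu> s)) A = 0"
    then have "AE v in lborel. ennreal (normal_density \<mu> s v) * indicator A v = 0"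
      using assms by (subst (asm) emeasure_density) (auto simp: nn_integral_0_iff_AE)
    then have "AE v in lborel. v \<notin> A"
      by eventually_elim (auto split: split_indicator_asm simp: ennreal_eq_0_iff pos)
    then have "emeasure lborel A = 0"
      using assms by (subst (asm) AE_iff_measurable[of A]) auto
    then show False using emeasure_lborel_open_pos[OF assms(2,3)] by simp
  qed
  then show ?thesis by (simp add: emeasure_eq_measure zero_less_measure_iff)
qed

lemma trunc_normal_density_nonneg: "0 \<le> trunc_normal_density \<mu> s A v"
  by (simp add: trunc_normal_density_def)

lemma trunc_normal_density_pos:
  assumes "s > 0" "open A" "v \<in> A"
  shows "0 < trunc_normal_density \<mu> s A v"
  using assms measure_normal_open_pos[of s A \<mu>] normal_density_pos[of s \<mu> v]
  by (auto simp: trunc_normal_density_def intro!: divide_pos_pos)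

lemma nn_integral_trunc_normal_density:
  assumes "s > 0" "open A" "A \<noteq> {}"
  shows "(\<integral>\<^sup>+v. ennreal (trunc_normal_density \<mu> s A v) \<partial>lborel) = 1"
proof -
  let ?c = "measure (density lborel (normal_density \<mu> s)) A"
  interpret prob_space "density lborel (normal_density \<mu> s)"
    using assms(1) by (rule prob_space_normal_density)
  have c: "?c > 0" using assms by (rule measure_normal_open_pos)
  have "(\<integral>\<^sup>+v. ennreal (trunc_normal_density \<mu> s A v) \<partial>lborel)
    = (\<integral>\<^sup>+v. ennreal (normal_density \<mu> s v) * indicator A v * ennreal (1 / ?c) \<partial>lborel)"
    using c by (intro nn_integral_cong)
      (auto simp: trunc_normal_density_def ennreal_mult[symmetric] split: split_indicator)
  also have "\<dots> = emeasure (density lborel (normal_density \<mu> s)) A * ennreal (1 / ?c)"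
    using assms by (subst nn_integral_multc) (auto simp: emeasure_density)
  also have "\<dots> = 1"
    using c by (simp add: emeasure_eq_measure ennreal_mult[symmetric])
  finally show ?thesis .
qed

section \<open>The proposal and the interpolated density\<close>

lemma lin_fun_upd:
  "l \<in> {1..p} \<Longrightarrow> lin p x (B((j, l) := v)) i j = lin_rest p x B i j l + x i l * v"
  by (subst (1) lin_def, subst sum.remove[of _ l]) (auto simp: lin_rest_def intro!: sum.cong)

lemma lin_fun_upd_other: "j' \<noteq> j \<Longrightarrow> lin p x (B((j, l) := v)) i j' = lin p x B i j'"
  by (simp add: lin_def)

lemma ext_lin_fun_upd: "j' \<noteq> j \<Longrightarrow> ext_lin p m x (B((j, l) := v)) i j' = ext_lin p m x B i j'"
  by (simp add: ext_lin_def lin_fun_upd_other)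

text \<open>Stated for extended \<open>e\<close>, so that the infinite planes with index 0 and
  \<open>m + 1\<close> are covered together with the finite ones.\<close>

lemma ereal_div_less_iff:
  fixes e :: ereal and s c v :: real
  shows "c > 0 \<Longrightarrow> (e - ereal s) / ereal c < ereal v \<longleftrightarrow> e < ereal (s + c * v)"
    "c > 0 \<Longrightarrow> ereal v < (e - ereal s) / ereal c \<longleftrightarrow> ereal (s + c * v) < e"
    "c < 0 \<Longrightarrow> (e - ereal s) / ereal c < ereal v \<longleftrightarrow> ereal (s + c * v) < e"
    "c < 0 \<Longrightarrow> ereal v < (e - ereal s) / ereal c \<longleftrightarrow> e < ereal (s + c * v)"
  by (cases e; auto simp: field_simps divide_ereal_def)+

lemma lower_i_upper_i_iff:
  assumes "x i l \<noteq> 0"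
  shows "lower_i p m x B j l i < ereal v \<and> ereal v < upper_i p m x B j l i \<longleftrightarrow>
    ext_lin p m x B i (j - 1) < ereal (lin_rest p x B i j l + x i l * v) \<and>
    ereal (lin_rest p x B i j l + x i l * v) < ext_lin p m x B i (j + 1)"
  using assms by (cases "x i l > 0") (auto simp: lower_i_def upper_i_def ereal_div_less_iff)

text \<open>The infinite sentinels make the inequalities at \<open>j = 0\<close> and
  \<open>j = m\<close> automatic. With them every plane has two neighbours and the outermost ones
  need no separate treatment.\<close>

lemma monotone_set_ext_lin:
  assumes "B \<in> space (coef_space p m)"
  shows "B \<in> monotone_set n p m x \<longleftrightarrow>
    (\<forall>i\<in>{1..n}. \<forall>j\<in>{0..m}. ext_lin p m x B i j < ext_lin p m x B i (j + 1))"
proof -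
  have "{0..m} = insert 0 (insert m {1..<m})" by auto
  then show ?thesis
    using assms by (auto simp: monotone_set_def ext_lin_def)
qed

lemma fun_upd_in_coef_space:
  "B \<in> space (coef_space p m) \<Longrightarrow> j \<in> {1..m} \<Longrightarrow> l \<in> {1..p} \<Longrightarrow> B((j, l) := v) \<in> space (coef_space p m)"
  by (auto simp: coef_space_def space_PiM PiE_iff extensional_def)

text \<open>The proposal interval is exactly the section of the constraint set along the selected
  coordinate. Only the inequalities between plane \<open>j\<close> and its two neighbours can
  change; where \<open>x i l = 0\<close> they do not change either and hold because \<open>B\<close>
  satisfies them.\<close>

lemma fun_upd_in_monotone_set_iff:
  assumes "n \<ge> 1" and B: "B \<in> monotone_set n p m x" and j: "j \<in> {1..m}" and l: "l \<in> {1..p}"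
  shows "B((j, l) := v) \<in> monotone_set n p m x \<longleftrightarrow>
    lower n p m x B j l < ereal v \<and> ereal v < upper n p m x B j l"
proof -
  let ?B' = "B((j, l) := v)"
  have space: "B \<in> space (coef_space p m)" using B by (simp add: monotone_set_def)
  note B_mono = B[unfolded monotone_set_ext_lin[OF space], rule_format]
  have new: "ext_lin p m x ?B' i j = ereal (lin_rest p x B i j l + x i l * v)" for i
    using j l by (simp add: ext_lin_def lin_fun_upd)
  have j': "j - 1 \<noteq> j" using j by auto
  have local: "lower_i p m x B j l i < ereal v \<and> ereal v < upper_i p m x B j l i \<longleftrightarrow>
      ext_lin p m x ?B' i (j - 1) < ext_lin p m x ?B' i j \<and>
      ext_lin p m x ?B' i j < ext_lin p m x ?B' i (j + 1)" if i: "i \<in> {1..n}" for i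
  proof (cases "x i l = 0")
    case True
    \<comment> \<open>Viewing \<open>B\<close> as an update of itself lets
      \<open>lin_fun_upd\<close> express the old plane through \<open>lin_rest\<close> too.\<close>
    have "B((j, l) := B (j, l)) = B" by simp
    then have "ext_lin p m x B i j = ereal (lin_rest p x B i j l)"
      using lin_fun_upd[OF l, of x B j "B (j, l)" i] True j by (simp add: ext_lin_def)
    then have "ext_lin p m x ?B' i j = ext_lin p m x B i j"
      using True by (simp add: new)
    then show ?thesis
      using True B_mono[OF i, of "j - 1"] B_mono[OF i, of j] j j'
      by (auto simp: lower_i_def upper_i_def ext_lin_fun_upd)
  next
    case False
    then show ?thesis
      using lower_i_upper_i_iff[of x i l p m B j v] j' by (simp add: new ext_lin_fun_upd)
  qed
  have others: "ext_lin p m x ?B' i k < ext_lin p m x ?B' i (k + 1)"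
    if "i \<in> {1..n}" "k \<in> {0..m}" "k \<noteq> j" "k + 1 \<noteq> j" for i k
    using B_mono[OF that(1,2)] that(3,4) by (simp add: ext_lin_fun_upd)
  have "?B' \<in> monotone_set n p m x \<longleftrightarrow> (\<forall>i\<in>{1..n}.
      ext_lin p m x ?B' i (j - 1) < ext_lin p m x ?B' i j \<and>
      ext_lin p m x ?B' i j < ext_lin p m x ?B' i (j + 1))" (is "_ \<longleftrightarrow> ?R")
  proof
    assume "?B' \<in> monotone_set n p m x"
    then have "\<forall>i\<in>{1..n}. \<forall>j\<in>{0..m}. ext_lin p m x ?B' i j < ext_lin p m x ?B' i (j + 1)"
      using monotone_set_ext_lin[OF fun_upd_in_coef_space[OF space j l]] by simp
    from this[rule_format, of _ "j - 1"] this[rule_format, of _ j] show ?R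
      using j by auto
  next
    assume R: ?R
    have "ext_lin p m x ?B' i k < ext_lin p m x ?B' i (k + 1)" if "i \<in> {1..n}" "k \<in> {0..m}" for i k
      using R that others[OF that] by (cases "k = j"; cases "k + 1 = j") auto
    then show "?B' \<in> monotone_set n p m x"
      using monotone_set_ext_lin[OF fun_upd_in_coef_space[OF space j l]] by simp
  qed
  also have "\<dots> \<longleftrightarrow> (\<forall>i\<in>{1..n}. lower_i p m x B j l i < ereal v \<and> ereal v < upper_i p m x B j l i)"
    using local by simp
  also have "\<dots> \<longleftrightarrow> lower n p m x B j l < ereal v \<and> ereal v < upper n p m x B j l"
    using \<open>n \<ge> 1\<close> by (auto simp: lower_def upper_def)
  finally show ?thesis .
qed

section \<open>Measurability of the bounds and of the proposal density\<close>

lemma measurable_coef_component: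
  "c \<in> {1..m} \<times> {1..p} \<Longrightarrow> (\<lambda>B. B c) \<in> borel_measurable (coef_space p m)"
  unfolding coef_space_def
  using measurable_component_singleton[of c "{1..m} \<times> {1..p}" "\<lambda>_. lborel :: real measure"]
  by (simp add: measurable_lborel1)

lemma measurable_lin:
  "j \<in> {1..m} \<Longrightarrow> (\<lambda>B. lin p x B i j) \<in> borel_measurable (coef_space p m)"
  unfolding lin_def by (intro borel_measurable_sum borel_measurable_times measurable_coef_component) auto

lemma measurable_lin_rest:
  "j \<in> {1..m} \<Longrightarrow> (\<lambda>B. lin_rest p x B i j l) \<in> borel_measurable (coef_space p m)"
  unfolding lin_rest_def by (intro borel_measurable_sum borel_measurable_times measurable_coef_component) auto

lemma measurable_ext_lin:
  "j \<in> {0..m + 1} \<Longrightarrow> (\<lambda>B. ext_lin p m x B i j) \<in> borel_measurable (coef_space p m)"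
  using measurable_lin[of j m p x i] by (cases "j = 0 \<or> j = m + 1") (auto simp: ext_lin_def)

lemma measurable_lower:
  assumes "j \<in> {1..m}"
  shows "(\<lambda>B. lower n p m x B j l) \<in> borel_measurable (coef_space p m)"
proof -
  have [measurable]: "(\<lambda>B. ext_lin p m x B i (j - 1)) \<in> borel_measurable (coef_space p m)"
    "(\<lambda>B. ext_lin p m x B i (j + 1)) \<in> borel_measurable (coef_space p m)"
    "(\<lambda>B. lin_rest p x B i j l) \<in> borel_measurable (coef_space p m)" for i
    using assms by (auto intro!: measurable_ext_lin measurable_lin_rest)
  show ?thesis unfolding lower_def lower_i_def by (intro borel_measurable_Max) auto
qed

lemma measurable_upper:
  assumes "j \<in> {1..m}"
  shows "(\<lambda>B. upper n p m x B j l) \<in> borel_measurable (coef_space p m)"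
proof -
  have [measurable]: "(\<lambda>B. ext_lin p m x B i (j - 1)) \<in> borel_measurable (coef_space p m)"
    "(\<lambda>B. ext_lin p m x B i (j + 1)) \<in> borel_measurable (coef_space p m)"
    "(\<lambda>B. lin_rest p x B i j l) \<in> borel_measurable (coef_space p m)" for i
    using assms by (auto intro!: measurable_ext_lin measurable_lin_rest)
  show ?thesis unfolding upper_def upper_i_def by (intro borel_measurable_Min) auto
qed

lemma sets_monotone_set: "monotone_set n p m x \<in> sets (coef_space p m)"
  unfolding monotone_set_def
  by (rule sets.sets_Collect_finite_All, rule sets.sets_Collect_finite_All)
    (auto intro!: borel_measurable_less measurable_lin)

text \<open>The delicate factor is the normalising constant, the measure of a varying set under a
  varying law. Written as an integral over \<open>u\<close> of a jointly measurable function of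
  \<open>(w, u)\<close>, it is measurable in \<open>w\<close>.\<close>

lemma measurable_trunc_normal_density:
  fixes A :: "'a \<Rightarrow> real set"
  assumes [measurable]: "\<mu> \<in> borel_measurable M" "s \<in> borel_measurable M"
    "Measurable.pred (M \<Otimes>\<^sub>M lborel) (\<lambda>(w, v). v \<in> A w)"
    and A: "\<And>w. A w \<in> sets borel"
  shows "(\<lambda>(w, v). trunc_normal_density (\<mu> w) (s w) (A w) v) \<in> borel_measurable (M \<Otimes>\<^sub>M lborel)"
proof -
  define ind :: "'a \<Rightarrow> real \<Rightarrow> real" where "ind w v = indicator (A w) v" for w v
  define pdf where "pdf w = normal_density (\<mu> w) (s w)" for w
  define c where "c w = measure (density lborel (pdf w)) (A w)" for w
  have ind_eq: "ind w v = (if v \<in> A w then 1 else 0)" for w v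
    by (simp add: ind_def indicator_def)
  have ind[measurable]: "(\<lambda>(w, v). ind w v) \<in> borel_measurable (M \<Otimes>\<^sub>M lborel)"
    unfolding ind_eq by measurable
  have pdf[measurable]: "(\<lambda>(w, v). pdf w v) \<in> borel_measurable (M \<Otimes>\<^sub>M lborel)"
    unfolding pdf_def normal_density_def by measurable
  have c_eq: "c w = enn2real (\<integral>\<^sup>+u. ennreal (pdf w u) * ennreal (ind w u) \<partial>lborel)" for w
    unfolding c_def measure_def using A
    by (subst emeasure_density) (auto simp: ind_def pdf_def ennreal_indicator)
  have [measurable]: "c \<in> borel_measurable M"
    unfolding c_eq by measurable
  have eq: "trunc_normal_density (\<mu> w) (s w) (A w) v = pdf w v * ind w v / c w" for w v
    by (simp add: trunc_normal_density_def c_def pdf_def ind_def)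
  show ?thesis
    unfolding eq by measurable
qed

lemma measurable_value_density:
  assumes j: "j \<in> {1..m}"
    and [measurable]: "loc j l \<in> borel_measurable (coef_space p m)" "spread j l \<in> borel_measurable (coef_space p m)"
  shows "(\<lambda>(B, v). value_density n p m x loc spread j l B v) \<in> borel_measurable (coef_space p m \<Otimes>\<^sub>M lborel)"
proof -
  note [measurable] = measurable_lower[OF j] measurable_upper[OF j]
  define I where "I B = {u. lower n p m x B j l < ereal u \<and> ereal u < upper n p m x B j l}" for B
  have mem: "v \<in> I B \<longleftrightarrow> lower n p m x B j l < ereal v \<and> ereal v < upper n p m x B j l" for B v
    by (simp add: I_def)
  have [measurable]: "Measurable.pred (coef_space p m \<Otimes>\<^sub>M lborel) (\<lambda>(B, v). v \<in> I B)"
    unfolding mem by measurable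
  define ind :: "coef \<Rightarrow> real \<Rightarrow> real" where "ind B v = (if v \<in> I B then 1 else 0)" for B v
  have ind[measurable]: "(\<lambda>(B, v). ind B v) \<in> borel_measurable (coef_space p m \<Otimes>\<^sub>M lborel)"
    unfolding ind_def by measurable
  define tnd where "tnd B v = trunc_normal_density (loc j l B) (spread j l B) (I B) v" for B v
  have I_borel: "I B \<in> sets borel" for B unfolding I_def by measurable
  have tnd[measurable]: "(\<lambda>(B, v). tnd B v) \<in> borel_measurable (coef_space p m \<Otimes>\<^sub>M lborel)"
    unfolding tnd_def by (rule measurable_trunc_normal_density) (use I_borel in measurable)
  have eq: "value_density n p m x loc spread j l B v =
     (if \<bar>lower n p m x B j l\<bar> \<noteq> \<infinity> \<and> \<bar>upper n p m x B j l\<bar> \<noteq> \<infinity>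
      then ind B v / (real_of_ereal (upper n p m x B j l) - real_of_ereal (lower n p m x B j l))
      else tnd B v)" for B v
    by (simp add: value_density_def Let_def I_def tnd_def ind_def indicator_def)
  show ?thesis
    unfolding eq by measurable
qed

section \<open>Sign, support and total mass of the proposal density\<close>

lemma open_ereal_interval: "open {u :: real. a < ereal u \<and> ereal u < b}"
  by (intro open_Collect_conj open_Collect_less) (auto intro!: continuous_intros)

text \<open>This includes states outside the constraint set, where the lower bound may exceed the
  upper one: the interval is then empty and the indicator vanishes. Such states occur because
  Fubini's theorem is applied on the whole product space.\<close>

lemma value_density_nonneg: "0 \<le> value_density n p m x loc spread j l B v"
proof -
  have "real_of_ereal a \<le> real_of_ereal b"
    if "a < ereal v" "ereal v < b" "\<bar>a\<bar> \<noteq> \<infinity>" "\<bar>b\<bar> \<noteq> \<infinity>" for a b :: ereal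
    using that by (cases a; cases b) auto
  then show ?thesis
    by (auto simp: value_density_def Let_def trunc_normal_density_nonneg split: split_indicator)
qed

context
  fixes n p m :: nat and x :: "nat \<Rightarrow> nat \<Rightarrow> real" and loc spread :: "nat \<Rightarrow> nat \<Rightarrow> coef \<Rightarrow> real"
    and B :: coef and j l :: nat
  assumes n: "n \<ge> 1" and B: "B \<in> monotone_set n p m x" and j: "j \<in> {1..m}" and l: "l \<in> {1..p}"
    and spread: "spread j l B > 0"
begin

text \<open>Serves in both directions: proposals cannot leave the constraint set, and from any
  admissible proposal the reverse move has positive density.\<close>

lemma value_density_pos_iff:
  "0 < value_density n p m x loc spread j l B v \<longleftrightarrow> B((j, l) := v) \<in> monotone_set n p m x"
proof -
  let ?I = "{u. lower n p m x B j l < ereal u \<and> ereal u < upper n p m x B j l}"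
  have "real_of_ereal a < real_of_ereal b"
    if "a < ereal v" "ereal v < b" "\<bar>a\<bar> \<noteq> \<infinity>" "\<bar>b\<bar> \<noteq> \<infinity>" for a b :: ereal
    using that by (cases a; cases b) auto
  moreover have "trunc_normal_density (loc j l B) (spread j l B) ?I v = 0" if "v \<notin> ?I"
    using that by (simp add: trunc_normal_density_def)
  moreover have "trunc_normal_density (loc j l B) (spread j l B) ?I v > 0" if "v \<in> ?I"
    using that spread by (intro trunc_normal_density_pos open_ereal_interval)
  ultimately show ?thesis
    unfolding fun_upd_in_monotone_set_iff[OF n B j l]
    by (auto simp: value_density_def Let_def split: split_indicator)
qed

lemma nn_integral_value_density:
  "(\<integral>\<^sup>+v. ennreal (value_density n p m x loc spread j l B v) \<partial>lborel) = 1"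
proof -
  define a where "a = lower n p m x B j l"
  define b where "b = upper n p m x B j l"
  \<comment> \<open>The current value of the component shows that the proposal interval is nonempty,
    so neither density is divided by 0.\<close>
  have "B((j, l) := B (j, l)) \<in> monotone_set n p m x" using B by simp
  then have mem: "a < ereal (B (j, l))" "ereal (B (j, l)) < b"
    unfolding fun_upd_in_monotone_set_iff[OF n B j l] by (auto simp: a_def b_def)
  show ?thesis
  proof (cases "\<bar>a\<bar> \<noteq> \<infinity> \<and> \<bar>b\<bar> \<noteq> \<infinity>")
    case True
    then obtain a' b' where ab: "a = ereal a'" "b = ereal b'" by (cases a; cases b) auto
    have "value_density n p m x loc spread j l B v = indicator {a'<..<b'} v / (b' - a')" for v
      by (auto simp: value_density_def Let_def a_def[symmetric] b_def[symmetric] ab split: split_indicator)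
    then have "(\<integral>\<^sup>+v. ennreal (value_density n p m x loc spread j l B v) \<partial>lborel)
      = (\<integral>\<^sup>+v. ennreal (1 / (b' - a')) * indicator {a'<..<b'} v \<partial>lborel)"
      by (intro nn_integral_cong) (auto split: split_indicator)
    also have "\<dots> = 1"
      using mem by (subst nn_integral_cmult_indicator) (auto simp: ab ennreal_mult[symmetric])
    finally show ?thesis .
  next
    case False
    then have "value_density n p m x loc spread j l B =
        trunc_normal_density (loc j l B) (spread j l B) {u. a < ereal u \<and> ereal u < b}"
      by (auto simp: value_density_def Let_def a_def b_def)
    then show ?thesis
      using spread mem by (auto intro!: nn_integral_trunc_normal_density open_ereal_interval)
  qed
qed

end

section \<open>Measurability, sign and zeros of the interpolated density\<close>

lemma monotone_set_lin_less:
  assumes "B \<in> monotone_set n p m x" "i \<in> {1..n}" "1 \<le> j" "j < k" "k \<le> m"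
  shows "lin p x B i j < lin p x B i k"
  using assms(4,5)
proof (induction k)
  case (Suc k)
  have "lin p x B i k < lin p x B i (Suc k)"
    using assms(1-3) Suc.prems by (auto simp: monotone_set_def)
  with Suc show ?case by (cases "j = k") auto
qed simp

lemma measurable_lid_density:
  assumes m: "m \<ge> 1"
  shows "(\<lambda>B. lid_density p m x \<tau> \<sigma> B i v) \<in> borel_measurable (coef_space p m)"
proof -
  have [measurable]: "(\<lambda>B. lin p x B i 1) \<in> borel_measurable (coef_space p m)"
    "(\<lambda>B. lin p x B i m) \<in> borel_measurable (coef_space p m)"
    using m by (auto intro: measurable_lin)
  have pair: "(\<lambda>B. (B, v)) \<in> coef_space p m \<rightarrow>\<^sub>M coef_space p m \<Otimes>\<^sub>M lborel" by simp
  have "(\<lambda>(B, v). trunc_normal_density (lin p x B i 1) \<sigma> {..<lin p x B i 1} v)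
      \<in> borel_measurable (coef_space p m \<Otimes>\<^sub>M lborel)"
    by (rule measurable_trunc_normal_density; (unfold lessThan_iff)?) measurable
  from measurable_compose[OF pair this]
  have [measurable]: "(\<lambda>B. trunc_normal_density (lin p x B i 1) \<sigma> {..<lin p x B i 1} v) \<in> borel_measurable (coef_space p m)"
    by simp
  have "(\<lambda>(B, v). trunc_normal_density (lin p x B i m) \<sigma> {lin p x B i m<..} v)
      \<in> borel_measurable (coef_space p m \<Otimes>\<^sub>M lborel)"
    by (rule measurable_trunc_normal_density; (unfold greaterThan_iff)?) measurable
  from measurable_compose[OF pair this]
  have [measurable]: "(\<lambda>B. trunc_normal_density (lin p x B i m) \<sigma> {lin p x B i m<..} v) \<in> borel_measurable (coef_space p m)"
    by simp
  have "(\<lambda>B. indicator {lin p x B i j<..<lin p x B i (j + 1)} v *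
        ((\<tau> (j + 1) - \<tau> j) / (lin p x B i (j + 1) - lin p x B i j))) \<in> borel_measurable (coef_space p m)"
    if "j \<in> {1..<m}" for j
  proof -
    have [measurable]: "(\<lambda>B. lin p x B i j) \<in> borel_measurable (coef_space p m)"
      "(\<lambda>B. lin p x B i (j + 1)) \<in> borel_measurable (coef_space p m)"
      using that by (auto intro!: measurable_lin)
    show ?thesis unfolding indicator_def greaterThanLessThan_iff by measurable
  qed
  note sum = borel_measurable_sum[of "{1..<m}", OF this]
  have ind: "(\<lambda>B. indicator {..<lin p x B i 1} v :: real) \<in> borel_measurable (coef_space p m)"
    "(\<lambda>B. indicator {lin p x B i m<..} v :: real) \<in> borel_measurable (coef_space p m)"
    unfolding indicator_def lessThan_iff greaterThan_iff by measurable
  show ?thesis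
    unfolding lid_density_def
    by (intro borel_measurable_add borel_measurable_times sum ind; measurable)
qed

lemma measurable_lid_likelihood:
  assumes "m \<ge> 1"
  shows "lid_likelihood n p m x y \<tau> \<sigma> \<in> borel_measurable (coef_space p m)"
proof -
  have "(\<lambda>B. lid_likelihood n p m x y \<tau> \<sigma> B) \<in> borel_measurable (coef_space p m)"
    unfolding lid_likelihood_def using assms by (intro borel_measurable_prod measurable_lid_density)
  then show ?thesis by simp
qed

context
  fixes n p m :: nat and x :: "nat \<Rightarrow> nat \<Rightarrow> real" and \<tau> :: "nat \<Rightarrow> real" and \<sigma> :: real and B i
  assumes m: "m \<ge> 1" and \<tau>: "0 < \<tau> 1" "strict_mono_on {1..m} \<tau>" "\<tau> m < 1" and \<sigma>: "\<sigma> > 0"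
    and B: "B \<in> monotone_set n p m x" and i: "i \<in> {1..n}"
begin

lemma lid_density_terms_nonneg:
  "j \<in> {1..<m} \<Longrightarrow> 0 \<le> indicator {lin p x B i j<..<lin p x B i (j + 1)} v *
    ((\<tau> (j + 1) - \<tau> j) / (lin p x B i (j + 1) - lin p x B i j))"
  "0 \<le> indicator {..<lin p x B i 1} v * (\<tau> 1 * trunc_normal_density (lin p x B i 1) \<sigma> {..<lin p x B i 1} v)"
  "0 \<le> indicator {lin p x B i m<..} v * ((1 - \<tau> m) * trunc_normal_density (lin p x B i m) \<sigma> {lin p x B i m<..} v)"
  using \<tau> strict_mono_onD[OF \<tau>(2), of j "j + 1"] monotone_set_lin_less[OF B i, of j "j + 1"]
  by (auto intro!: mult_nonneg_nonneg divide_nonneg_nonneg trunc_normal_density_nonneg)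

lemma lid_density_nonneg: "0 \<le> lid_density p m x \<tau> \<sigma> B i v"
  unfolding lid_density_def by (intro add_nonneg_nonneg sum_nonneg lid_density_terms_nonneg)

lemma lid_density_pos:
  assumes v: "\<forall>j\<in>{1..m}. v \<noteq> lin p x B i j"
  shows "0 < lid_density p m x \<tau> \<sigma> B i v"
proof -
  consider "v < lin p x B i 1" | "lin p x B i m < v"
    | j where "j \<in> {1..<m}" "lin p x B i j < v" "v < lin p x B i (j + 1)"
  proof (cases "lin p x B i 1 < v")
    case True
    \<comment> \<open>The last plane below \<open>v\<close>; the next one is not below
      \<open>v\<close>, and by \<open>v\<close> avoiding all planes it lies strictly above.\<close>
    define j where "j = Max {j \<in> {1..m}. lin p x B i j < v}"
    have fin: "finite {j \<in> {1..m}. lin p x B i j < v}" by simp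
    have j: "j \<in> {j \<in> {1..m}. lin p x B i j < v}"
      unfolding j_def using True m by (intro Max_in) auto
    show ?thesis
    proof (cases "j = m")
      case False
      have "\<not> lin p x B i (j + 1) < v"
      proof
        assume "lin p x B i (j + 1) < v"
        then have "j + 1 \<le> j"
          unfolding j_def[symmetric] using j False fin by (subst (2) j_def) (intro Max_ge, auto)
        then show False by simp
      qed
      then show ?thesis using that(3)[of j] j False v by (force simp: not_less order_le_less)
    qed (use j that(2) in auto)
  qed (use v m that(1) in \<open>auto simp: not_less order_le_less\<close>)
  then show ?thesis
  proof cases
    case 1
    then have "0 < indicator {..<lin p x B i 1} v * (\<tau> 1 * trunc_normal_density (lin p x B i 1) \<sigma> {..<lin p x B i 1} v)"
      using \<tau> \<sigma> by (auto intro!: mult_pos_pos trunc_normal_density_pos)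
    then show ?thesis
      unfolding lid_density_def
      by (intro add_pos_nonneg add_nonneg_pos sum_nonneg lid_density_terms_nonneg)
  next
    case 2
    then have "0 < indicator {lin p x B i m<..} v * ((1 - \<tau> m) * trunc_normal_density (lin p x B i m) \<sigma> {lin p x B i m<..} v)"
      using \<tau> \<sigma> by (auto intro!: mult_pos_pos trunc_normal_density_pos)
    then show ?thesis
      unfolding lid_density_def
      by (intro add_nonneg_pos add_nonneg_nonneg sum_nonneg lid_density_terms_nonneg)
  next
    case 3
    then have "0 < indicator {lin p x B i j<..<lin p x B i (j + 1)} v *
        ((\<tau> (j + 1) - \<tau> j) / (lin p x B i (j + 1) - lin p x B i j))"
      using strict_mono_onD[OF \<tau>(2), of j "j + 1"] by auto
    then have "0 < (\<Sum>j = 1..<m. indicator {lin p x B i j<..<lin p x B i (j + 1)} v *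
        ((\<tau> (j + 1) - \<tau> j) / (lin p x B i (j + 1) - lin p x B i j)))"
      using 3(1) lid_density_terms_nonneg(1) by (intro sum_pos2[of _ j]) auto
    then show ?thesis
      unfolding lid_density_def
      by (intro add_pos_nonneg lid_density_terms_nonneg)
  qed
qed

text \<open>All cells are open and the planes are strictly ordered, so a plane value belongs to no
  cell. Hence the likelihood has zeros inside the constraint set, and these are the states where the
  acceptance ratio needs a convention.\<close>

lemma lid_density_eq_0:
  assumes j: "j \<in> {1..m}" "v = lin p x B i j"
  shows "lid_density p m x \<tau> \<sigma> B i v = 0"
proof -
  have less: "lin p x B i k < lin p x B i k'" if "1 \<le> k" "k < k'" "k' \<le> m" for k k'
    using monotone_set_lin_less[OF B i] that by blast
  have "v \<notin> {lin p x B i k<..<lin p x B i (k + 1)}" if "k \<in> {1..<m}" for k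
    using less[of j k] less[of "k + 1" j] j that
    by (cases j k rule: linorder_cases; cases "j = k + 1") force+
  moreover have "\<not> v < lin p x B i 1"
    using less[of 1 j] j by (cases "j = 1") auto
  moreover have "\<not> lin p x B i m < v"
    using less[of j m] j by (cases "j = m") auto
  ultimately show ?thesis
    unfolding lid_density_def by simp
qed

end

section \<open>Detailed balance\<close>

text \<open>Every function on a count space is measurable, so a mixture over a random index asks
  nothing of the dependence of \<open>f\<close> on it.\<close>

lemma uniform_bind:
  assumes A: "finite A" "A \<noteq> {}" and f: "\<And>a. a \<in> A \<Longrightarrow> f a \<in> space (subprob_algebra N)"
  shows "sets (uniform_count_measure A \<bind> f) = sets N"
    and "X \<in> sets N \<Longrightarrow>
      emeasure (uniform_count_measure A \<bind> f) X = ennreal (1 / card A) * (\<Sum>a\<in>A. emeasure (f a) X)"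
proof -
  have space: "space (uniform_count_measure A) = A" by (simp add: space_uniform_count_measure)
  have "f \<in> count_space A \<rightarrow>\<^sub>M subprob_algebra N" using f by simp
  then have meas: "f \<in> uniform_count_measure A \<rightarrow>\<^sub>M subprob_algebra N"
    by (simp add: measurable_cong_sets[OF sets_uniform_count_measure_count_space refl])
  show "sets (uniform_count_measure A \<bind> f) = sets N"
    using f A(2) by (intro sets_bind) (auto simp: space space_subprob_algebra)
  assume X: "X \<in> sets N"
  show "emeasure (uniform_count_measure A \<bind> f) X = ennreal (1 / card A) * (\<Sum>a\<in>A. emeasure (f a) X)"
    using emeasure_bind[OF _ meas X, unfolded space] A
    by (simp add: uniform_count_measure_def nn_integral_point_measure_finite sum_distrib_left)
qed

locale lid_chain =
  fixes n p m :: nat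
    and x :: "nat \<Rightarrow> nat \<Rightarrow> real" and y :: "nat \<Rightarrow> real"
    and \<tau> :: "nat \<Rightarrow> real" and \<sigma> :: real
    and prior :: "coef \<Rightarrow> real"
    and loc spread :: "nat \<Rightarrow> nat \<Rightarrow> coef \<Rightarrow> real"
  assumes n: "n \<ge> 1" and p: "p \<ge> 1" and m: "m \<ge> 1"
    and \<tau>: "0 < \<tau> 1" "strict_mono_on {1..m} \<tau>" "\<tau> m < 1"
    and \<sigma>: "\<sigma> > 0"
    and prior_measurable[measurable]: "prior \<in> borel_measurable (coef_space p m)"
    and prior_nonneg: "B \<in> space (coef_space p m) \<Longrightarrow> 0 \<le> prior B"
    and prior_outside: "B \<in> space (coef_space p m) \<Longrightarrow> B \<notin> monotone_set n p m x \<Longrightarrow> prior B = 0"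
    and loc_measurable: "j \<in> {1..m} \<Longrightarrow> l \<in> {1..p} \<Longrightarrow> loc j l \<in> borel_measurable (coef_space p m)"
    and spread_measurable: "j \<in> {1..m} \<Longrightarrow> l \<in> {1..p} \<Longrightarrow> spread j l \<in> borel_measurable (coef_space p m)"
    and spread_pos: "j \<in> {1..m} \<Longrightarrow> l \<in> {1..p} \<Longrightarrow> B \<in> monotone_set n p m x \<Longrightarrow> spread j l B > 0"
begin

abbreviation L where "L \<equiv> coef_space p m"
abbreviation S where "S \<equiv> monotone_set n p m x"
abbreviation lik where "lik \<equiv> lid_likelihood n p m x y \<tau> \<sigma>"
abbreviation vd where "vd \<equiv> value_density n p m x loc spread"
abbreviation acc where "acc \<equiv> accept_prob n p m x y \<tau> \<sigma> prior loc spread"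
abbreviation kern where "kern \<equiv> lid_kernel n p m x y \<tau> \<sigma> prior loc spread"
abbreviation target where "target B \<equiv> prior B * lik B"

lemma S_sets[measurable]: "S \<in> sets L" by (rule sets_monotone_set)

lemma S_space: "B \<in> S \<Longrightarrow> B \<in> space L" by (simp add: monotone_set_def)

lemma lik_measurable[measurable]: "lik \<in> borel_measurable L"
  using m by (rule measurable_lid_likelihood)

lemma target_measurable[measurable]: "(\<lambda>B. target B) \<in> borel_measurable L" by measurable

lemma lik_nonneg: "B \<in> S \<Longrightarrow> 0 \<le> lik B"
  unfolding lid_likelihood_def using lid_density_nonneg[OF m \<tau> \<sigma>] by (intro prod_nonneg) auto

lemma lik_pos_iff: "B \<in> S \<Longrightarrow> 0 < lik B \<longleftrightarrow> (\<forall>i\<in>{1..n}. \<forall>j\<in>{1..m}. y i \<noteq> lin p x B i j)"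
proof
  assume B: "B \<in> S" and "\<forall>i\<in>{1..n}. \<forall>j\<in>{1..m}. y i \<noteq> lin p x B i j"
  then show "0 < lik B"
    unfolding lid_likelihood_def by (intro prod_pos ballI lid_density_pos[OF m \<tau> \<sigma>]) auto
next
  assume B: "B \<in> S" and pos: "0 < lik B"
  show "\<forall>i\<in>{1..n}. \<forall>j\<in>{1..m}. y i \<noteq> lin p x B i j"
  proof (rule ccontr)
    assume "\<not> ?thesis"
    then obtain i j where ij: "i \<in> {1..n}" "j \<in> {1..m}" "y i = lin p x B i j" by auto
    then have "lik B = 0"
      unfolding lid_likelihood_def using lid_density_eq_0[OF m \<tau> \<sigma> B ij]
      by (intro prod_zero bexI[OF _ ij(1)]) simp_all
    then show False using pos by simp
  qed
qed

lemma target_outside: "B \<in> space L \<Longrightarrow> B \<notin> S \<Longrightarrow> target B = 0"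
  by (simp add: prior_outside)

lemma target_nonneg: "B \<in> space L \<Longrightarrow> 0 \<le> target B"
  using prior_nonneg[of B] lik_nonneg[of B] target_outside[of B] by (cases "B \<in> S") auto

definition move :: "nat \<Rightarrow> nat \<Rightarrow> coef \<Rightarrow> real \<Rightarrow> coef measure" where
  "move j l B v = measure_pmf (bernoulli_pmf (acc j l B (B((j, l) := v)))) \<bind>
     (\<lambda>b. return L (if b then B((j, l) := v) else B))"

definition update :: "nat \<Rightarrow> nat \<Rightarrow> coef \<Rightarrow> coef measure" where
  "update j l B = density lborel (vd j l B) \<bind> move j l B"

text \<open>For \<open>B \<in> S\<close> this is the mass that \<open>update j l B\<close> gives to
  \<open>E\<close>. The explicit integral is also available for states outside \<open>S\<close>, so
  measurability and invariance can be treated on the product space \<open>L\<close>.\<close>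

definition update_mass :: "nat \<Rightarrow> nat \<Rightarrow> coef set \<Rightarrow> coef \<Rightarrow> ennreal" where
  "update_mass j l E B = (\<integral>\<^sup>+v. ennreal (vd j l B v) *
     (ennreal (acc j l B (B((j, l) := v))) * indicator E (B((j, l) := v))
      + ennreal (1 - acc j l B (B((j, l) := v))) * indicator E B) \<partial>lborel)"

context
  fixes j l
  assumes j: "j \<in> {1..m}" and l: "l \<in> {1..p}"
begin

lemma upd_space: "B \<in> space L \<Longrightarrow> B((j, l) := v) \<in> space L"
  using j l by (intro fun_upd_in_coef_space)

lemma upd_measurable[measurable]: "(\<lambda>(B, v). B((j, l) := v)) \<in> L \<Otimes>\<^sub>M lborel \<rightarrow>\<^sub>M L"
proof -
  have "insert (j, l) ({1..m} \<times> {1..p}) = {1..m} \<times> {1..p}" using j l by auto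
  then show ?thesis
    using measurable_add_dim[of "(j, l)" "{1..m} \<times> {1..p}" "\<lambda>_. lborel :: real measure"]
    by (simp only: coef_space_def)
qed

lemma comp_measurable[measurable]: "(\<lambda>B. B (j, l)) \<in> borel_measurable L"
  using j l by (intro measurable_coef_component) auto

lemma vd_measurable[measurable]: "(\<lambda>(B, v). vd j l B v) \<in> borel_measurable (L \<Otimes>\<^sub>M lborel)"
  using j l by (intro measurable_value_density loc_measurable spread_measurable)

lemma vd_pair_measurable[measurable]:
  "(\<lambda>(B, B'). vd j l B (B' (j, l))) \<in> borel_measurable (L \<Otimes>\<^sub>M L)"
  "(\<lambda>(B, B'). vd j l B' (B (j, l))) \<in> borel_measurable (L \<Otimes>\<^sub>M L)"
proof -
  have c: "(\<lambda>w. snd w (j, l)) \<in> L \<Otimes>\<^sub>M L \<rightarrow>\<^sub>M lborel" "(\<lambda>w. fst w (j, l)) \<in> L \<Otimes>\<^sub>M L \<rightarrow>\<^sub>M lborel"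
    using measurable_compose[OF measurable_snd comp_measurable, of L]
      measurable_compose[OF measurable_fst comp_measurable, of L]
    by (simp_all add: measurable_cong_sets[OF refl sets_lborel])
  show "(\<lambda>(B, B'). vd j l B (B' (j, l))) \<in> borel_measurable (L \<Otimes>\<^sub>M L)"
    "(\<lambda>(B, B'). vd j l B' (B (j, l))) \<in> borel_measurable (L \<Otimes>\<^sub>M L)"
    using measurable_compose[OF measurable_Pair[OF measurable_fst c(1)] vd_measurable]
      measurable_compose[OF measurable_Pair[OF measurable_snd c(2)] vd_measurable]
    by (simp_all add: split_beta')
qed

lemma acc_measurable[measurable]: "(\<lambda>(B, B'). acc j l B B') \<in> borel_measurable (L \<Otimes>\<^sub>M L)"
  unfolding accept_prob_def proposal_density_def Let_def by measurable

lemma acc_le_1: "acc j l B B' \<le> 1"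
  by (simp add: accept_prob_def Let_def)

lemma acc_nonneg: "B \<in> space L \<Longrightarrow> B' \<in> space L \<Longrightarrow> 0 \<le> acc j l B B'"
  using target_nonneg[of B] target_nonneg[of B']
  by (auto simp: accept_prob_def proposal_density_def Let_def
      intro!: divide_nonneg_nonneg mult_nonneg_nonneg value_density_nonneg)

text \<open>Both sides are the minimum of the two unnormalised flows.\<close>

lemma detailed_balance:
  assumes "B \<in> space L" "B' \<in> space L"
  shows "target B * vd j l B (B' (j, l)) * acc j l B B' = target B' * vd j l B' (B (j, l)) * acc j l B' B"
proof -
  let ?c = "1 / real m * (1 / real p)"
  define a where "a = target B * vd j l B (B' (j, l))"
  define b where "b = target B' * vd j l B' (B (j, l))"
  have c: "?c > 0" using m p by simp
  have ab: "a \<ge> 0" "b \<ge> 0"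
    using assms by (auto simp: a_def b_def intro!: mult_nonneg_nonneg[OF target_nonneg] value_density_nonneg)
  \<comment> \<open>The selection probability \<open>?c\<close> cancels. If exactly one of the flows
    \<open>a\<close>, \<open>b\<close> is 0, the convention accepts on that side, while the other
    side accepts with probability 0; so both products vanish.\<close>
  have acc: "acc j l B B' = (if a = 0 then 1 else min 1 (b / a))"
    "acc j l B' B = (if b = 0 then 1 else min 1 (a / b))"
    using c by (auto simp: accept_prob_def proposal_density_def Let_def a_def b_def mult.commute mult.left_commute)
  show ?thesis
    unfolding a_def[symmetric] b_def[symmetric] acc using ab
    by (auto simp: min_def field_simps split: if_splits)
qed

lemma update_mass_measurable:
  assumes [measurable]: "E \<in> sets L"
  shows "update_mass j l E \<in> borel_measurable L"
proof -
  have [measurable]: "(\<lambda>(B, v). acc j l B (B((j, l) := v))) \<in> borel_measurable (L \<Otimes>\<^sub>M lborel)" by measurable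
  have "(\<lambda>B. update_mass j l E B) \<in> borel_measurable L" unfolding update_mass_def by measurable
  then show ?thesis by simp
qed

context
  fixes B assumes B: "B \<in> S"
begin

lemma acc_upd_measurable[measurable]: "(\<lambda>v. acc j l B (B((j, l) := v))) \<in> borel_measurable lborel"
proof -
  have [measurable]: "(\<lambda>(B, v). acc j l B (B((j, l) := v))) \<in> borel_measurable (L \<Otimes>\<^sub>M lborel)" by measurable
  show ?thesis using S_space[OF B] by measurable
qed

lemma upd_B_measurable[measurable]: "(\<lambda>v. B((j, l) := v)) \<in> lborel \<rightarrow>\<^sub>M L"
  using S_space[OF B] by measurable

lemma vd_B_measurable[measurable]: "vd j l B \<in> borel_measurable lborel"
proof -
  have "(\<lambda>v. vd j l B v) \<in> borel_measurable lborel" using S_space[OF B] by measurable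
  then show ?thesis by simp
qed

lemma move_properties:
  shows "prob_space (move j l B v)" "sets (move j l B v) = sets L"
    and "E \<in> sets L \<Longrightarrow> emeasure (move j l B v) E = ennreal (acc j l B (B((j, l) := v))) * indicator E (B((j, l) := v))
     + ennreal (1 - acc j l B (B((j, l) := v))) * indicator E B"
proof -
  have space: "B \<in> space L" "B((j, l) := v) \<in> space L" using S_space[OF B] upd_space by auto
  have ret: "(\<lambda>b. return L (if b then B((j, l) := v) else B))
      \<in> measure_pmf (bernoulli_pmf (acc j l B (B((j, l) := v)))) \<rightarrow>\<^sub>M subprob_algebra L"
    using space by (auto simp: space_subprob_algebra intro!: prob_space_imp_subprob_space prob_space_return)
  show "prob_space (move j l B v)"
    unfolding move_def using space
    by (intro measure_pmf.prob_space_bind[OF _ ret]) (auto intro!: AE_I2 prob_space_return)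
  show "sets (move j l B v) = sets L"
    unfolding move_def by (subst sets_bind) auto
  show "emeasure (move j l B v) E = ennreal (acc j l B (B((j, l) := v))) * indicator E (B((j, l) := v))
     + ennreal (1 - acc j l B (B((j, l) := v))) * indicator E B" if "E \<in> sets L"
    unfolding move_def using that acc_nonneg[OF space] acc_le_1[of B "B((j, l) := v)"]
    by (subst emeasure_bind[OF _ ret]) (auto simp: mult.commute)
qed

lemma move_measurable: "move j l B \<in> lborel \<rightarrow>\<^sub>M subprob_algebra L"
proof (rule measurable_subprob_algebra)
  fix E assume [measurable]: "E \<in> sets L"
  show "(\<lambda>v. emeasure (move j l B v) E) \<in> borel_measurable lborel"
    by (simp add: move_properties)
qed (use move_properties in \<open>auto intro: prob_space_imp_subprob_space\<close>)

lemma prob_space_vd: "prob_space (density lborel (vd j l B))"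
  by (rule prob_spaceI)
    (simp add: emeasure_density nn_integral_value_density[where loc = loc and spread = spread, OF n B j l spread_pos[OF j l B]])

lemma update_properties:
  shows "prob_space (update j l B)" "sets (update j l B) = sets L"
    and "E \<in> sets L \<Longrightarrow> emeasure (update j l B) E = update_mass j l E B"
proof -
  interpret prob_space "density lborel (vd j l B)" by (rule prob_space_vd)
  have move_measurable': "move j l B \<in> density lborel (vd j l B) \<rightarrow>\<^sub>M subprob_algebra L"
    using move_measurable by simp
  show "prob_space (update j l B)"
    unfolding update_def using move_properties(1) by (intro prob_space_bind[OF _ move_measurable']) simp
  show "sets (update j l B) = sets L"
    unfolding update_def by (subst sets_bind) (use move_properties in auto)
  show "emeasure (update j l B) E = update_mass j l E B" if E: "E \<in> sets L"
  proof -
    have "emeasure (update j l B) E = (\<integral>\<^sup>+v. emeasure (move j l B v) E \<partial>density lborel (vd j l B))"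
      unfolding update_def using E by (intro emeasure_bind[OF _ move_measurable']) simp
    also have "\<dots> = (\<integral>\<^sup>+v. ennreal (vd j l B v) * emeasure (move j l B v) E \<partial>lborel)"
      using measurable_compose[OF move_measurable measurable_emeasure_subprob_algebra[OF E]]
      by (intro nn_integral_density) auto
    finally show ?thesis using E by (simp add: update_mass_def move_properties)
  qed
qed

text \<open>Values leading out of \<open>S\<close> have proposal density 0. For all others both
  possible next states lie in \<open>S\<close>, and the weights of acceptance and rejection add up
  to 1.\<close>

lemma update_mass_S: "update_mass j l S B = 1"
proof -
  have "update_mass j l S B = (\<integral>\<^sup>+v. ennreal (vd j l B v) \<partial>lborel)"
    unfolding update_mass_def
  proof (intro nn_integral_cong)
    fix v
    let ?B' = "B((j, l) := v)"
    have "vd j l B v = 0" if "?B' \<notin> S"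
      using that value_density_pos_iff[where v = v and loc = loc and spread = spread, OF n B j l spread_pos[OF j l B]]
        value_density_nonneg[of n p m x loc spread j l B v] by force
    moreover have "ennreal (acc j l B ?B') + ennreal (1 - acc j l B ?B') = 1"
      using acc_nonneg[OF S_space[OF B] upd_space[OF S_space[OF B]]] acc_le_1
      by (simp add: ennreal_plus[symmetric] del: ennreal_plus)
    ultimately show "ennreal (vd j l B v) * (ennreal (acc j l B ?B') * indicator S ?B' +
        ennreal (1 - acc j l B ?B') * indicator S B) = ennreal (vd j l B v)"
      using B by (cases "?B' \<in> S") auto
  qed
  then show ?thesis using nn_integral_value_density[where loc = loc and spread = spread, OF n B j l spread_pos[OF j l B]] by simp
qed

end

text \<open>Split the mass into \<open>flow\<close>, the accepted part, and \<open>rest\<close>, the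
  rejected part. Exchanging state and proposal and then applying \<open>detailed_balance\<close>
  turns the accepted mass arriving in \<open>E\<close> into the accepted mass starting in
  \<open>E\<close>. Together with the rejected mass in \<open>E\<close> this is all the mass that
  started there.\<close>

lemma update_invariant:
  assumes E[measurable]: "E \<in> sets L"
  shows "(\<integral>\<^sup>+B. ennreal (target B) * update_mass j l E B \<partial>L) = (\<integral>\<^sup>+B. ennreal (target B) * indicator E B \<partial>L)"
proof -
  interpret product_sigma_finite "\<lambda>_ :: nat \<times> nat. lborel :: real measure"
    by (simp add: product_sigma_finite_def sigma_finite_lborel)
  define flow where "flow B B' = ennreal (target B * vd j l B (B' (j, l)) * acc j l B B')" for B B'
  define rest where "rest B v = ennreal (target B * vd j l B v * (1 - acc j l B (B((j, l) := v))))" for B v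
  have flow[measurable]: "(\<lambda>(B, B'). flow B B') \<in> borel_measurable (L \<Otimes>\<^sub>M L)"
    unfolding flow_def by measurable
  have [measurable]: "(\<lambda>(B, v). acc j l B (B((j, l) := v))) \<in> borel_measurable (L \<Otimes>\<^sub>M lborel)"
    by measurable
  have rest[measurable]: "(\<lambda>(B, v). rest B v) \<in> borel_measurable (L \<Otimes>\<^sub>M lborel)"
    unfolding rest_def by measurable
  have [measurable]: "(\<lambda>(B, v). flow B (B((j, l) := v))) \<in> borel_measurable (L \<Otimes>\<^sub>M lborel)"
    by measurable
  have "(\<integral>\<^sup>+B. ennreal (target B) * update_mass j l E B \<partial>L)
    = (\<integral>\<^sup>+B. \<integral>\<^sup>+v. flow B (B((j, l) := v)) * indicator E (B((j, l) := v)) + rest B v * indicator E B \<partial>lborel \<partial>L)"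
  proof (intro nn_integral_cong)
    fix B assume B: "B \<in> space L"
    have *: "ennreal (target B) * (ennreal (vd j l B v) * (ennreal (acc j l B (B((j, l) := v))) * indicator E (B((j, l) := v))
        + ennreal (1 - acc j l B (B((j, l) := v))) * indicator E B))
      = flow B (B((j, l) := v)) * indicator E (B((j, l) := v)) + rest B v * indicator E B" for v
    proof -
      let ?B' = "B((j, l) := v)"
      have T: "0 \<le> target B" and V: "0 \<le> vd j l B v" and A: "0 \<le> acc j l B ?B'" "0 \<le> 1 - acc j l B ?B'"
        using target_nonneg[OF B] value_density_nonneg acc_nonneg[OF B upd_space[OF B]] acc_le_1[of B ?B']
        by auto
      have "flow B ?B' = ennreal (target B) * (ennreal (vd j l B v) * ennreal (acc j l B ?B'))"
        "rest B v = ennreal (target B) * (ennreal (vd j l B v) * ennreal (1 - acc j l B ?B'))"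
        unfolding flow_def rest_def fun_upd_same ennreal_mult[OF mult_nonneg_nonneg[OF T V] A(1)]
          ennreal_mult[OF mult_nonneg_nonneg[OF T V] A(2)] ennreal_mult[OF T V] by (rule mult.assoc)+
      then show ?thesis by (simp add: distrib_left mult.assoc)
    qed
    have [measurable]: "(\<lambda>v. vd j l B v) \<in> borel_measurable lborel"
      "(\<lambda>v. acc j l B (B((j, l) := v))) \<in> borel_measurable lborel"
      "(\<lambda>v. B((j, l) := v)) \<in> lborel \<rightarrow>\<^sub>M L" using B by measurable
    show "ennreal (target B) * update_mass j l E B
      = (\<integral>\<^sup>+v. flow B (B((j, l) := v)) * indicator E (B((j, l) := v)) + rest B v * indicator E B \<partial>lborel)"
      unfolding update_mass_def *[symmetric] using B
      by (intro nn_integral_cmult[symmetric]) measurable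
  qed
  also have "\<dots> = (\<integral>\<^sup>+B. \<integral>\<^sup>+v. flow B (B((j, l) := v)) * indicator E (B((j, l) := v)) \<partial>lborel \<partial>L)
      + (\<integral>\<^sup>+B. \<integral>\<^sup>+v. rest B v * indicator E B \<partial>lborel \<partial>L)"
    by (subst nn_integral_add[symmetric]; measurable?)
      (intro nn_integral_cong nn_integral_add; measurable)
  also have "(\<integral>\<^sup>+B. \<integral>\<^sup>+v. flow B (B((j, l) := v)) * indicator E (B((j, l) := v)) \<partial>lborel \<partial>L)
    = (\<integral>\<^sup>+B. \<integral>\<^sup>+v. flow (B((j, l) := v)) B * indicator E B \<partial>lborel \<partial>L)"
  proof -
    have "(\<lambda>(B, B'). flow B B' * indicator E B') \<in> borel_measurable (L \<Otimes>\<^sub>M L)" by measurable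
    then show ?thesis
      using nn_integral_fun_upd_swap[of "{1..m} \<times> {1..p}" "(j, l)" "\<lambda>B B'. flow B B' * indicator E B'",
          folded coef_space_def] j l by simp
  qed
  also have "\<dots> = (\<integral>\<^sup>+B. \<integral>\<^sup>+v. flow B (B((j, l) := v)) * indicator E B \<partial>lborel \<partial>L)"
    using upd_space by (intro nn_integral_cong) (simp add: flow_def detailed_balance)
  also have "\<dots> + (\<integral>\<^sup>+B. \<integral>\<^sup>+v. rest B v * indicator E B \<partial>lborel \<partial>L)
    = (\<integral>\<^sup>+B. \<integral>\<^sup>+v. flow B (B((j, l) := v)) * indicator E B + rest B v * indicator E B \<partial>lborel \<partial>L)"
    by (subst nn_integral_add[symmetric]; measurable?)
      (intro nn_integral_cong nn_integral_add[symmetric]; measurable)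
  also have "\<dots> = (\<integral>\<^sup>+B. ennreal (target B) * indicator E B \<partial>L)"
  proof (intro nn_integral_cong)
    fix B assume B: "B \<in> space L"
    have *: "flow B (B((j, l) := v)) * indicator E B + rest B v * indicator E B
      = ennreal (vd j l B v) * (ennreal (target B) * indicator E B)" for v
    proof -
      have "flow B (B((j, l) := v)) + rest B v = ennreal (target B * vd j l B v * acc j l B (B((j, l) := v))
          + target B * vd j l B v * (1 - acc j l B (B((j, l) := v))))"
        unfolding flow_def rest_def
        using target_nonneg[OF B] value_density_nonneg acc_nonneg[OF B upd_space[OF B]] acc_le_1
        by (subst ennreal_plus) (auto intro!: mult_nonneg_nonneg)
      also have "\<dots> = ennreal (vd j l B v) * ennreal (target B)"
        using target_nonneg[OF B] value_density_nonneg
        by (subst ennreal_mult[symmetric]) (auto simp: algebra_simps)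
      finally show ?thesis by (auto split: split_indicator)
    qed
    have [measurable]: "(\<lambda>v. vd j l B v) \<in> borel_measurable lborel" using B by measurable
    show "(\<integral>\<^sup>+v. flow B (B((j, l) := v)) * indicator E B + rest B v * indicator E B \<partial>lborel)
      = ennreal (target B) * indicator E B"
    \<comment> \<open>Outside \<open>S\<close> the proposal density need not have integral 1, but
      there the target is 0.\<close>
    proof (cases "B \<in> S")
      case True
      then show ?thesis
        unfolding * by (simp add: nn_integral_multc nn_integral_value_density[where loc = loc and spread = spread, OF n True j l spread_pos[OF j l True]])
    next
      case False
      then show ?thesis unfolding * using target_outside[OF B] by auto
    qed
  qed
  finally show ?thesis .
qed

end

section \<open>The kernel as a uniform mixture of coordinate updates\<close>

definition kernel_mass :: "coef set \<Rightarrow> coef \<Rightarrow> ennreal" where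
  "kernel_mass E B = ennreal (1 / m) * (\<Sum>j\<in>{1..m}. ennreal (1 / p) * (\<Sum>l\<in>{1..p}. update_mass j l E B))"

lemma kernel_mass_measurable: "E \<in> sets L \<Longrightarrow> kernel_mass E \<in> borel_measurable L"
proof -
  assume E: "E \<in> sets L"
  have "(\<lambda>B. kernel_mass E B) \<in> borel_measurable L"
    unfolding kernel_mass_def
    by (intro borel_measurable_times_ennreal borel_measurable_sum update_mass_measurable E) auto
  then show ?thesis by simp
qed

lemma uniform_weight: "k \<ge> 1 \<Longrightarrow> ennreal (1 / real k) * (\<Sum>i\<in>{1..k}. c) = c"
  by (simp add: ennreal_of_nat_eq_real_of_nat mult.assoc[symmetric] ennreal_mult[symmetric])

text \<open>Invariance of the target is linear in the kernel and the weights add up to 1, so it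
  passes from the updates to their mixture.\<close>

lemma kernel_mass_invariant:
  assumes E: "E \<in> sets L"
  shows "(\<integral>\<^sup>+B. ennreal (target B) * kernel_mass E B \<partial>L) = (\<integral>\<^sup>+B. ennreal (target B) * indicator E B \<partial>L)"
    (is "_ = ?R")
proof -
  have meas: "(\<lambda>B. ennreal (target B) * update_mass j l E B) \<in> borel_measurable L"
    if "j \<in> {1..m}" "l \<in> {1..p}" for j l
  proof -
    have [measurable]: "update_mass j l E \<in> borel_measurable L" by (rule update_mass_measurable[OF that E])
    show ?thesis by measurable
  qed
  have "(\<integral>\<^sup>+B. ennreal (target B) * kernel_mass E B \<partial>L)
    = (\<integral>\<^sup>+B. ennreal (1 / m) * (\<Sum>j\<in>{1..m}. ennreal (1 / p) * (\<Sum>l\<in>{1..p}. ennreal (target B) * update_mass j l E B)) \<partial>L)"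
    by (intro nn_integral_cong) (simp add: kernel_mass_def sum_distrib_left ac_simps)
  also have "\<dots> = ennreal (1 / m) * (\<Sum>j\<in>{1..m}. ennreal (1 / p) * (\<Sum>l\<in>{1..p}. \<integral>\<^sup>+B. ennreal (target B) * update_mass j l E B \<partial>L))"
  proof -
    have sum_l: "(\<lambda>B. \<Sum>l\<in>{1..p}. ennreal (target B) * update_mass j l E B) \<in> borel_measurable L"
      if "j \<in> {1..m}" for j
      by (intro borel_measurable_sum meas that)
    have sum_j: "(\<lambda>B. ennreal (1 / p) * (\<Sum>l\<in>{1..p}. ennreal (target B) * update_mass j l E B)) \<in> borel_measurable L"
      if "j \<in> {1..m}" for j
      by (intro borel_measurable_times_ennreal borel_measurable_const sum_l that)
    show ?thesis
      by (subst nn_integral_cmult, intro borel_measurable_sum sum_j, assumption,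
          subst nn_integral_sum, rule sum_j, assumption,
          intro arg_cong2[where f = "(*)"] refl sum.cong,
          subst nn_integral_cmult, rule sum_l, assumption,
          subst nn_integral_sum, rule meas, assumption, assumption, rule refl)
  qed
  also have "\<dots> = ennreal (1 / m) * (\<Sum>j\<in>{1..m}. ennreal (1 / p) * (\<Sum>l\<in>{1..p}. ?R))"
    using update_invariant[OF _ _ E] by simp
  also have "\<dots> = ?R"
    using m p by (simp only: uniform_weight)
  finally show ?thesis .
qed

text \<open>Before the restriction the mixture is a probability measure on \<open>L\<close>;
  restricting it to \<open>S\<close> loses no mass, as every update stays in \<open>S\<close> almost
  surely.\<close>

lemma kern_properties:
  assumes B: "B \<in> S"
  shows "prob_space (kern B)" "sets (kern B) = sets (state_space n p m x)"
    and "E \<in> sets L \<Longrightarrow> E \<subseteq> S \<Longrightarrow> emeasure (kern B) E = kernel_mass E B"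
proof -
  define sweep where "sweep j = uniform_count_measure {1..p} \<bind> (\<lambda>l. update j l B)" for j
  define U where "U = uniform_count_measure {1..m} \<bind> sweep"
  have kern_eq: "kern B = restrict_space U S"
    unfolding lid_kernel_def U_def sweep_def[abs_def] update_def[abs_def] move_def[abs_def] Let_def ..
  have upd: "update j l B \<in> space (subprob_algebra L)" if "j \<in> {1..m}" "l \<in> {1..p}" for j l
    using update_properties[OF that B] by (simp add: space_subprob_algebra prob_space_imp_subprob_space)
  have sweep: "sets (sweep j) = sets L"
    "E \<in> sets L \<Longrightarrow> emeasure (sweep j) E = ennreal (1 / p) * (\<Sum>l\<in>{1..p}. update_mass j l E B)"
    if j: "j \<in> {1..m}" for j E
    unfolding sweep_def using uniform_bind[of "{1..p}" "\<lambda>l. update j l B" L, OF _ _ upd[OF j]] p update_properties(3)[OF j _ B]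
    by (simp_all)
  have mass_1: "update_mass j l (space L) B = 1" if "j \<in> {1..m}" "l \<in> {1..p}" for j l
    using update_properties[OF that B] prob_space.emeasure_space_1 sets_eq_imp_space_eq
    by (metis sets.top)
  have "prob_space (sweep j)" if j: "j \<in> {1..m}" for j
  proof (rule prob_spaceI)
    have "emeasure (sweep j) (space L) = ennreal (1 / p) * (\<Sum>l\<in>{1..p}. 1)"
      using sweep(2)[OF j, of "space L"] mass_1[OF j] by simp
    then show "emeasure (sweep j) (space (sweep j)) = 1"
      using uniform_weight[OF p, of 1] sets_eq_imp_space_eq[OF sweep(1)[OF j]] by simp
  qed
  then have sweep_space: "sweep j \<in> space (subprob_algebra L)" if "j \<in> {1..m}" for j
    using sweep(1) that by (simp add: space_subprob_algebra prob_space_imp_subprob_space)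
  have U: "sets U = sets L" "E \<in> sets L \<Longrightarrow> emeasure U E = kernel_mass E B" for E
    unfolding U_def kernel_mass_def using uniform_bind[of "{1..m}" sweep L, OF _ _ sweep_space] m sweep(2)
    by simp_all
  show E: "emeasure (kern B) E = kernel_mass E B" if "E \<in> sets L" "E \<subseteq> S" for E
    unfolding kern_eq using that U by (subst emeasure_restrict_space) auto
  show "sets (kern B) = sets (state_space n p m x)"
    unfolding kern_eq state_space_def using U(1) by (rule sets_restrict_space_cong)
  then have "space (kern B) = S"
    using S_sets sets.sets_into_space
    by (subst sets_eq_imp_space_eq) (auto simp: state_space_def space_restrict_space)
  moreover have "kernel_mass S B = 1"
    unfolding kernel_mass_def using update_mass_S[OF _ _ B] uniform_weight[OF m, of 1] uniform_weight[OF p, of 1] by simp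
  ultimately show "prob_space (kern B)"
    using E[of S] by (intro prob_spaceI) simp
qed

lemma sets_state_space_iff: "E \<in> sets (state_space n p m x) \<longleftrightarrow> E \<in> sets L \<and> E \<subseteq> S"
  unfolding state_space_def using S_sets sets.sets_into_space[OF S_sets]
  by (subst sets_restrict_space_iff) (auto simp: Int_absorb1)

lemma space_state_space: "space (state_space n p m x) = S"
  using sets.sets_into_space[OF S_sets] by (auto simp: state_space_def space_restrict_space)

text \<open>No measurability of the nested binds in the state is needed: on \<open>S\<close> the
  masses coincide with \<open>kernel_mass\<close>, which is measurable on all of
  \<open>L\<close>.\<close>

lemma kern_measurable: "kern \<in> state_space n p m x \<rightarrow>\<^sub>M prob_algebra (state_space n p m x)"
proof (rule measurable_prob_algebraI, simp add: space_state_space kern_properties(1))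
  show "kern \<in> state_space n p m x \<rightarrow>\<^sub>M subprob_algebra (state_space n p m x)"
  proof (rule measurable_subprob_algebra)
    fix E assume "E \<in> sets (state_space n p m x)"
    then have E: "E \<in> sets L" "E \<subseteq> S" by (auto simp: sets_state_space_iff)
    have "kernel_mass E \<in> borel_measurable (state_space n p m x)"
      unfolding state_space_def by (intro measurable_restrict_space1 kernel_mass_measurable E)
    then show "(\<lambda>B. emeasure (kern B) E) \<in> borel_measurable (state_space n p m x)"
      by (rule measurable_cong[THEN iffD1, rotated]) (simp add: space_state_space kern_properties(3) E)
  qed (auto simp: space_state_space kern_properties prob_space_imp_subprob_space)
qed

lemma posterior_stationary:
  assumes int: "integrable L (\<lambda>B. target B)" and ev: "evidence n p m x y \<tau> \<sigma> prior > 0"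
  shows "stationary_distribution (state_space n p m x) kern (posterior n p m x y \<tau> \<sigma> prior)"
proof -
  let ?ev = "evidence n p m x y \<tau> \<sigma> prior" and ?N = "posterior n p m x y \<tau> \<sigma> prior"
  have ev_eq: "(\<integral>\<^sup>+B. ennreal (target B) \<partial>L) = ennreal ?ev"
    unfolding evidence_def using int target_nonneg by (intro nn_integral_eq_integral) (auto intro!: AE_I2)
  have sets_N: "sets ?N = sets (state_space n p m x)" by (simp add: posterior_def)
  have [measurable]: "(\<lambda>B. target B) \<in> borel_measurable (state_space n p m x)"
    unfolding state_space_def by (intro measurable_restrict_space1) measurable
  \<comment> \<open>Integrals against the posterior become integrals over the whole product space;
    the restriction to \<open>S\<close> may be dropped because the target vanishes outside.\<close>
  have nn: "(\<integral>\<^sup>+B. f B \<partial>?N) = ennreal (1 / ?ev) * (\<integral>\<^sup>+B. ennreal (target B) * f B \<partial>L)"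
    if f[measurable]: "f \<in> borel_measurable L" for f
  proof -
    have [measurable]: "f \<in> borel_measurable (state_space n p m x)"
      unfolding state_space_def by (intro measurable_restrict_space1 f)
    have "(\<integral>\<^sup>+B. f B \<partial>?N) = (\<integral>\<^sup>+B. ennreal (target B / ?ev) * f B \<partial>state_space n p m x)"
      unfolding posterior_def by (subst nn_integral_density) auto
    also have "\<dots> = (\<integral>\<^sup>+B. ennreal (target B / ?ev) * f B * indicator S B \<partial>L)"
      unfolding state_space_def using S_sets by (subst nn_integral_restrict_space) auto
    also have "\<dots> = (\<integral>\<^sup>+B. ennreal (1 / ?ev) * (ennreal (target B) * f B) \<partial>L)"
    proof (intro nn_integral_cong)
      fix B assume B: "B \<in> space L"
      show "ennreal (target B / ?ev) * f B * indicator S B = ennreal (1 / ?ev) * (ennreal (target B) * f B)"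
      proof (cases "B \<in> S")
        case True
        then show ?thesis
          using target_nonneg[OF B] ev by (simp add: mult.assoc[symmetric] ennreal_mult[symmetric])
      next
        case False
        then have "target B = 0" using target_outside[OF B] by simp
        then show ?thesis using False by (simp only:) simp
      qed
    qed
    also have "\<dots> = ennreal (1 / ?ev) * (\<integral>\<^sup>+B. ennreal (target B) * f B \<partial>L)"
      by (intro nn_integral_cmult) measurable
    finally show ?thesis .
  qed
  have "(\<integral>\<^sup>+B. 1 \<partial>?N) = 1"
    using ev by (subst nn) (auto simp: ev_eq ennreal_mult[symmetric])
  then have prob: "prob_space ?N" by (intro prob_spaceI) simp
  have "?N \<bind> kern = ?N"
  proof (rule measure_eqI)
    have N_space: "?N \<in> space (prob_algebra (state_space n p m x))"
      using prob sets_N by (simp add: space_prob_algebra)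
    show sets: "sets (?N \<bind> kern) = sets ?N"
      using sets_bind'[OF N_space kern_measurable] sets_N by simp
    fix E assume "E \<in> sets (?N \<bind> kern)"
    then have E_state: "E \<in> sets (state_space n p m x)" using sets sets_N by simp
    then have E: "E \<in> sets L" "E \<subseteq> S" by (auto simp: sets_state_space_iff)
    have "emeasure (?N \<bind> kern) E = (\<integral>\<^sup>+B. emeasure (kern B) E \<partial>?N)"
      by (rule emeasure_bind_prob_algebra[OF N_space kern_measurable E_state])
    also have "\<dots> = (\<integral>\<^sup>+B. kernel_mass E B \<partial>?N)"
      using E sets_eq_imp_space_eq[OF sets_N]
      by (intro nn_integral_cong) (simp add: space_state_space kern_properties(3))
    also have "\<dots> = (\<integral>\<^sup>+B. indicator E B \<partial>?N)"
      using E by (simp add: nn kernel_mass_measurable kernel_mass_invariant)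
    also have "\<dots> = emeasure ?N E" using E_state sets_N by simp
    finally show "emeasure (?N \<bind> kern) E = emeasure ?N E" .
  qed
  then show ?thesis
    unfolding stationary_distribution_def
    using prob sets_N kern_measurable by (simp add: space_prob_algebra)
qed

end

section \<open>Irreducibility\<close>

lemma override_on_measurable:
  assumes "f \<in> space (PiM I M)" "J \<subseteq> I"
  shows "(\<lambda>g. override_on f g J) \<in> PiM I M \<rightarrow>\<^sub>M PiM I M"
proof (rule measurable_PiM_single')
  fix i assume i: "i \<in> I"
  then have "f i \<in> space (M i)" using assms(1) by (auto simp: space_PiM)
  then show "(\<lambda>g. override_on f g J i) \<in> PiM I M \<rightarrow>\<^sub>M M i"
    using i by (cases "i \<in> J") (simp_all add: override_on_def)
next
  show "(\<lambda>g. override_on f g J) \<in> space (PiM I M) \<rightarrow> (\<Pi>\<^sub>E i\<in>I. space (M i))"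
    using assms by (fastforce simp: space_PiM override_on_def PiE_iff extensional_def)
qed

lemma override_on_insert_eq: "override_on f g (insert c J) = (override_on f g J)(c := g c)"
  by (auto simp: override_on_def)

text \<open>The coordinates of \<open>f\<close> listed in \<open>cs\<close> are replaced one by one
  by those of a random \<open>g\<close>. Each replacement has a null set of bad values, which
  depends on the coordinates already replaced; since \<open>cs\<close> is distinct, the fresh
  coordinate of \<open>g\<close> is independent of them and Fubini's theorem applies.\<close>

lemma (in product_sigma_finite) AE_override_on:
  assumes I: "finite I" and S: "S \<in> sets (PiM I M)" and A: "A \<in> sets (PiM I M)" and f: "f \<in> A"
    and step: "\<And>f c. f \<in> A \<Longrightarrow> c \<in> I \<Longrightarrow> AE v in M c. f(c := v) \<in> S \<longrightarrow> f(c := v) \<in> A"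
    and cs: "distinct cs" "set cs \<subseteq> I"
  shows "AE g in PiM I M. (\<forall>k\<le>length cs. override_on f g (set (take k cs)) \<in> S) \<longrightarrow> override_on f g (set cs) \<in> A"
  using cs
proof (induction cs rule: rev_induct)
  case Nil
  then show ?case using f by simp
next
  case (snoc c cs)
  let ?pre = "\<lambda>g cs. \<forall>k\<in>{..length cs}. override_on f g (set (take k cs)) \<in> S"
  \<comment> \<open>The induction claim becomes a premise here, so that only those \<open>g\<close>
    matter whose previous state is in \<open>A\<close>; the two almost-sure statements are combined
    at the end.\<close>
  let ?Q = "\<lambda>g. (?pre g cs \<longrightarrow> override_on f g (set cs) \<in> A) \<longrightarrow> ?pre g (cs @ [c]) \<longrightarrow>
    override_on f g (set (cs @ [c])) \<in> A"
  have f_space: "f \<in> space (PiM I M)" using f A sets.sets_into_space by blast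
  have c: "c \<in> I" "c \<notin> set cs" using snoc.prems by auto
  have take_sub: "set (take k ds) \<subseteq> I" if "set ds \<subseteq> I" for k ds
    using that set_take_subset by fast
  have meas: "Measurable.pred (PiM I M) (\<lambda>g. override_on f g J \<in> E)"
    if "J \<subseteq> I" "E \<in> sets (PiM I M)" for J E
    using override_on_measurable[OF f_space that(1)] that(2) by measurable
  have "AE g in PiM I M. ?Q g"
  proof (rule AE_PiM_fun_upd[OF I c(1)])
    have pred_pre: "Measurable.pred (PiM I M) (\<lambda>g. ?pre g ds)" if "set ds \<subseteq> I" for ds
      using take_sub[OF that] S by (intro pred_intros_finite meas) auto
    have "Measurable.pred (PiM I M) ?Q"
      using snoc.prems A by (intro pred_intros_logic pred_pre meas) auto
    then show "{g \<in> space (PiM I M). ?Q g} \<in> sets (PiM I M)"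
      by (simp add: pred_def)
  next
    fix g
    \<comment> \<open>The earlier states of the path do not look at coordinate \<open>c\<close> of
      \<open>g\<close>, so they stay fixed while \<open>v\<close> varies.\<close>
    have upd: "override_on f (g(c := v)) J = override_on f g J" if "c \<notin> J" for v J
      using that by (auto simp: override_on_def)
    have not_in: "c \<notin> set (take k cs)" for k using c(2) in_set_takeD by fast
    have pre_upd: "?pre (g(c := v)) cs = ?pre g cs" for v
      using upd[OF not_in] by simp
    have pre_snoc: "?pre h (cs @ [c]) \<longleftrightarrow> ?pre h cs \<and> override_on f h (insert c (set cs)) \<in> S" for h
    proof -
      have "{..length (cs @ [c])} = insert (Suc (length cs)) {..length cs}" by auto
      then show ?thesis by auto
    qed
    show "AE v in M c. ?Q (g(c := v))"
    proof (cases "?pre g cs \<and> override_on f g (set cs) \<in> A")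
      case True
      have "AE v in M c. (override_on f g (set cs))(c := v) \<in> S \<longrightarrow> (override_on f g (set cs))(c := v) \<in> A"
        using True c by (intro step) auto
      then show ?thesis
        by eventually_elim (use pre_snoc in \<open>simp add: override_on_insert_eq upd[OF c(2)]\<close>)
    next
      case False
      then show ?thesis unfolding pre_snoc pre_upd upd[OF c(2)] by (intro AE_I2) auto
    qed
  qed
  moreover have "AE g in PiM I M. ?pre g cs \<longrightarrow> override_on f g (set cs) \<in> A"
    using snoc by (simp add: Ball_def)
  ultimately show ?case
    by eventually_elim auto
qed

lemma AE_lborel_interval_witness:
  fixes a b :: real
  assumes "a < b" "AE v in lborel. P v"
  obtains v where "a < v" "v < b" "P v"
proof (rule ccontr)
  assume "\<not> thesis"
  then have "AE v in lborel. v \<notin> {a<..<b}"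
    using assms(2) that by (auto elim!: eventually_mono)
  then have "emeasure lborel {a<..<b} = 0"
    by (subst (asm) AE_iff_measurable[of "{a<..<b}"]) auto
  then show False using assms(1) by simp
qed

section \<open>Absorbing sets under a positive prior\<close>

locale lid_chain_pos = lid_chain +
  assumes intercept: "i \<in> {1..n} \<Longrightarrow> x i 1 = 1"
    and prior_pos: "B \<in> S \<Longrightarrow> prior B > 0"
begin

text \<open>If \<open>lik B = 0\<close>, the denominator of the ratio is 0 and the proposal is
  accepted. Otherwise the numerator is positive unless an updated plane hits \<open>y i\<close>,
  which happens for at most one value of \<open>v\<close> per \<open>i\<close>, as planes with
  \<open>x i l = 0\<close> do not move.\<close>

lemma AE_acc_pos:
  assumes B: "B \<in> S" and j: "j \<in> {1..m}" and l: "l \<in> {1..p}"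
  shows "AE v in lborel. B((j, l) := v) \<in> S \<longrightarrow> acc j l B (B((j, l) := v)) > 0"
proof (cases "lik B > 0")
  case False
  then have "lik B = 0" using lik_nonneg[OF B] by simp
  then show ?thesis by (simp add: accept_prob_def)
next
  case True
  then have lin_B: "y i \<noteq> lin p x B i k" if "i \<in> {1..n}" "k \<in> {1..m}" for i k
    using lik_pos_iff[OF B] that by blast
  \<comment> \<open>The quotient is the value that puts plane \<open>j\<close> on
    \<open>y i\<close>. For \<open>x i l = 0\<close> it is 0 by the convention for division, which
    merely excludes one more point.\<close>
  have "AE v in lborel. \<forall>i\<in>{1..n}. v \<noteq> (y i - lin_rest p x B i j l) / x i l"
    by (subst AE_finite_all) (auto intro: AE_lborel_singleton)
  then show ?thesis
  proof eventually_elim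
    fix v assume v: "\<forall>i\<in>{1..n}. v \<noteq> (y i - lin_rest p x B i j l) / x i l"
    let ?B' = "B((j, l) := v)"
    show "?B' \<in> S \<longrightarrow> acc j l B ?B' > 0"
    proof
      assume B': "?B' \<in> S"
      have "y i \<noteq> lin p x ?B' i k" if i: "i \<in> {1..n}" and k: "k \<in> {1..m}" for i k
      proof (cases "k = j \<and> x i l \<noteq> 0")
        case True
        then show ?thesis using v[rule_format, OF i] by (auto simp: lin_fun_upd[OF l] field_simps)
      next
        case False
        have "lin p x ?B' i k = lin p x B i k"
          using False lin_fun_upd[OF l, of x B j "B (j, l)" i]
          by (cases "k = j") (simp_all add: lin_fun_upd[OF l] lin_fun_upd_other)
        then show ?thesis using lin_B[OF i k] by simp
      qed
      then have "0 < lik ?B'" using lik_pos_iff[OF B'] by blast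
      moreover have "0 < vd j l ?B' (B (j, l))"
        using value_density_pos_iff[where v = "B (j, l)" and loc = loc and spread = spread, OF n B' j l spread_pos[OF j l B']] B
        by simp
      ultimately have num: "0 < target ?B' * proposal_density n p m x loc spread j l ?B' B"
        using prior_pos[OF B'] m p by (simp add: proposal_density_def)
      have "0 \<le> target B * proposal_density n p m x loc spread j l B ?B'"
        by (rule mult_nonneg_nonneg[OF target_nonneg[OF S_space[OF B]]])
          (simp add: proposal_density_def value_density_nonneg)
      moreover have "0 < (if b = 0 then 1 else min 1 (a / b))" if "0 < a" "0 \<le> b" for a b :: real
        using that by simp
      ultimately show "acc j l B ?B' > 0"
        unfolding accept_prob_def Let_def using num by blast
    qed
  qed
qed

text \<open>All coordinates are selected with positive probability, so no single update gives mass
  to \<open>S - A\<close>. Proposal density and acceptance probability are positive at almost every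
  admissible value, hence almost no such value leads into \<open>S - A\<close>.\<close>

lemma absorbing_fun_upd:
  assumes A: "A \<in> sets L" "A \<subseteq> S" and B: "B \<in> A" and absorbing: "measure (kern B) A = 1"
    and j: "j \<in> {1..m}" and l: "l \<in> {1..p}"
  shows "AE v in lborel. B((j, l) := v) \<in> S \<longrightarrow> B((j, l) := v) \<in> A"
proof -
  have BS: "B \<in> S" using A B by auto
  interpret prob_space "kern B" using kern_properties(1)[OF BS] .
  have E[measurable]: "S - A \<in> sets L" using A by auto
  have "space (kern B) = S"
    using sets_eq_imp_space_eq[OF kern_properties(2)[OF BS]] by (simp add: space_state_space)
  then have "emeasure (kern B) (S - A) = 0"
    using prob_compl[of A] absorbing A kern_properties(2)[OF BS] by (simp add: emeasure_eq_measure sets_state_space_iff)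
  then have "kernel_mass (S - A) B = 0"
    using kern_properties(3)[OF BS E] by simp
  then have "update_mass j l (S - A) B = 0"
    using j l m p by (auto simp: kernel_mass_def sum_eq_0_iff ennreal_eq_0_iff divide_le_0_iff)
  moreover have [measurable]: "(\<lambda>v. acc j l B (B((j, l) := v))) \<in> borel_measurable lborel"
    "(\<lambda>v. B((j, l) := v)) \<in> lborel \<rightarrow>\<^sub>M L" "vd j l B \<in> borel_measurable lborel"
    using acc_upd_measurable[OF j l BS] upd_B_measurable[OF j l BS] vd_B_measurable[OF j l BS] by auto
  ultimately have "AE v in lborel. ennreal (vd j l B v) * (ennreal (acc j l B (B((j, l) := v))) * indicator (S - A) (B((j, l) := v))
     + ennreal (1 - acc j l B (B((j, l) := v))) * indicator (S - A) B) = 0"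
    unfolding update_mass_def by (subst (asm) nn_integral_0_iff_AE) measurable
  then show ?thesis
    using AE_acc_pos[OF BS j l]
  proof eventually_elim
    fix v
    assume zero: "ennreal (vd j l B v) * (ennreal (acc j l B (B((j, l) := v))) * indicator (S - A) (B((j, l) := v))
       + ennreal (1 - acc j l B (B((j, l) := v))) * indicator (S - A) B) = 0"
      and pos: "B((j, l) := v) \<in> S \<longrightarrow> 0 < acc j l B (B((j, l) := v))"
    show "B((j, l) := v) \<in> S \<longrightarrow> B((j, l) := v) \<in> A"
    proof (intro impI, rule ccontr)
      assume S: "B((j, l) := v) \<in> S" and "B((j, l) := v) \<notin> A"
      moreover have "0 < vd j l B v"
        using S value_density_pos_iff[where v = v and loc = loc and spread = spread, OF n BS j l spread_pos[OF j l BS]] by simp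
      ultimately show False
        using zero pos by (auto simp: ennreal_eq_0_iff)
    qed
  qed
qed

lemma lin_intercept:
  "i \<in> {1..n} \<Longrightarrow> lin p x B i j = B (j, 1) + lin_rest p x B i j 1"
  using lin_fun_upd[of 1 p x B j "B (j, 1)" i] p intercept by simp

text \<open>The double sum dominates every row of the data, so one constant serves for all
  observations. The index set \<open>T\<close> is either complete or lacks the intercept.\<close>

lemma abs_weighted_sum_le:
  assumes i: "i \<in> {1..n}" and T: "T \<subseteq> {1..p}" and R: "\<And>t. t \<in> T \<Longrightarrow> \<bar>B (j, t)\<bar> \<le> R" "0 \<le> R"
  shows "\<bar>\<Sum>t\<in>T. x i t * B (j, t)\<bar> \<le> (\<Sum>i\<in>{1..n}. \<Sum>t\<in>{1..p}. \<bar>x i t\<bar>) * R"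
proof -
  have "\<bar>\<Sum>t\<in>T. x i t * B (j, t)\<bar> \<le> (\<Sum>t\<in>T. \<bar>x i t\<bar> * R)"
    using R by (intro order_trans[OF sum_abs] sum_mono) (auto simp: abs_mult intro!: mult_left_mono)
  also have "\<dots> = (\<Sum>t\<in>T. \<bar>x i t\<bar>) * R" by (simp add: sum_distrib_right)
  also have "(\<Sum>t\<in>T. \<bar>x i t\<bar>) \<le> (\<Sum>t\<in>{1..p}. \<bar>x i t\<bar>)"
    using T by (intro sum_mono2) auto
  also have "\<dots> \<le> (\<Sum>i\<in>{1..n}. \<Sum>t\<in>{1..p}. \<bar>x i t\<bar>)"
    using i by (intro member_le_sum[of i "{1..n}" "\<lambda>i. \<Sum>t\<in>{1..p}. \<bar>x i t\<bar>"]) (auto intro: sum_nonneg)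
  finally show ?thesis using R(2) by (auto intro: mult_right_mono)
qed

text \<open>
  The planes above index \<open>k\<close> have intercepts near multiples of \<open>4 D\<close>; their slopes are too small to
  disturb the order that this imposes.
\<close>

lemma separated_in_S:
  assumes C: "C \<in> space L" and k: "k \<le> m"
    and D: "(\<Sum>i\<in>{1..n}. \<Sum>t\<in>{1..p}. \<bar>x i t\<bar>) * R < D" "0 \<le> R"
    and high: "\<And>j. j \<in> {k<..m} \<Longrightarrow> 4 * D * real j < C (j, 1) \<and> C (j, 1) < 4 * D * real j + D"
    and slope: "\<And>j t. j \<in> {k<..m} \<Longrightarrow> t \<in> {2..p} \<Longrightarrow> \<bar>C (j, t)\<bar> \<le> R"
    and low: "B \<in> S" "\<And>j t. j \<in> {1..k} \<Longrightarrow> t \<in> {1..p} \<Longrightarrow> C (j, t) = B (j, t)"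
      "\<And>j t. j \<in> {1..k} \<Longrightarrow> t \<in> {1..p} \<Longrightarrow> \<bar>B (j, t)\<bar> \<le> R"
  shows "C \<in> S"
proof -
  have D_pos: "D > 0"
    using D by (smt (verit) sum_nonneg abs_ge_zero mult_nonneg_nonneg)
  \<comment> \<open>The intercept lies in a window of length \<open>D\<close> above
    \<open>4 * D * j\<close>, and the slopes contribute less than \<open>D\<close> in absolute
    value. The next plane stays above \<open>4 * D * j + 3 * D\<close>, so the factor 4 keeps the
    ranges disjoint.\<close>
  have high_lin: "4 * D * real j - D < lin p x C i j \<and> lin p x C i j < 4 * D * real j + 2 * D"
    if i: "i \<in> {1..n}" and j: "j \<in> {k<..m}" for i j
  proof -
    have "\<bar>lin_rest p x C i j 1\<bar> < D"
      unfolding lin_rest_def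
      by (rule order.strict_trans1[OF abs_weighted_sum_le[OF i, where R = R] D(1)]) (use slope[OF j] D(2) in auto)
    then show ?thesis using high[OF j] by (auto simp: lin_intercept[OF i] abs_less_iff)
  qed
  \<comment> \<open>The low planes are those of \<open>B\<close>, hence in order among themselves;
    being below \<open>D\<close>, they are also below all high planes.\<close>
  have low_lin: "lin p x C i j = lin p x B i j" "lin p x C i j < D"
    if i: "i \<in> {1..n}" and j: "j \<in> {1..k}" for i j
  proof -
    show eq: "lin p x C i j = lin p x B i j"
      unfolding lin_def using low(2)[OF j] by (intro sum.cong) auto
    have "\<bar>lin p x B i j\<bar> < D"
      unfolding lin_def
      by (rule order.strict_trans1[OF abs_weighted_sum_le[OF i, where R = R] D(1)]) (use low(3)[OF j] D(2) in auto)
    then show "lin p x C i j < D" using eq by simp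
  qed
  have "lin p x C i j < lin p x C i (j + 1)" if i: "i \<in> {1..n}" and j: "j \<in> {1..<m}" for i j
  proof -
    consider "j < k" | "j = k" | "j > k" by linarith
    then show ?thesis
    proof cases
      case 1
      then show ?thesis
        using low_lin(1)[OF i, of j] low_lin(1)[OF i, of "j + 1"] monotone_set_lin_less[OF low(1) i, of j "j + 1"] j
        by auto
    next
      case 2
      have "lin p x C i j < D"
        using 2 low_lin(2)[OF i, of j] j by auto
      also have "D \<le> 4 * D * real (j + 1) - D"
      proof -
        have "0 \<le> D * real j" using D_pos by simp
        moreover have "4 * D * real (j + 1) = 4 * (D * real j) + 4 * D" by (simp add: algebra_simps)
        ultimately show ?thesis using D_pos by linarith
      qed
      also have "\<dots> < lin p x C i (j + 1)"
        using 2 high_lin[OF i, of "j + 1"] j by auto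
      finally show ?thesis .
    next
      case 3
      then show ?thesis
        using high_lin[OF i, of j] high_lin[OF i, of "j + 1"] j D_pos by (auto simp: algebra_simps)
    qed
  qed
  then show ?thesis using C by (simp add: monotone_set_def)
qed

context
  fixes A
  assumes A: "A \<in> sets L" "A \<subseteq> S"
    and stays: "\<And>B j l. B \<in> A \<Longrightarrow> j \<in> {1..m} \<Longrightarrow> l \<in> {1..p} \<Longrightarrow>
      AE v in lborel. B((j, l) := v) \<in> S \<longrightarrow> B((j, l) := v) \<in> A"
begin

text \<open>Since only almost every new value is known to stay in \<open>A\<close>, each intercept
  is placed somewhere in a window of positive length instead of at a given point. The induction runs
  downwards from \<open>k = m\<close>, so a raised plane meets only planes that are already
  higher.\<close>

lemma raise_intercepts:
  assumes B: "B \<in> A" and D: "(\<Sum>i\<in>{1..n}. \<Sum>t\<in>{1..p}. \<bar>x i t\<bar>) * R < D" "0 \<le> R"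
    and R: "\<And>j t. j \<in> {1..m} \<Longrightarrow> t \<in> {1..p} \<Longrightarrow> \<bar>B (j, t)\<bar> \<le> R"
    and k: "k \<le> m"
  shows "\<exists>C\<in>A. (\<forall>j\<in>{k<..m}. 4 * D * real j < C (j, 1) \<and> C (j, 1) < 4 * D * real j + D) \<and>
    (\<forall>j t. t \<noteq> 1 \<or> j \<le> k \<longrightarrow> C (j, t) = B (j, t))"
  using k
proof (induction k rule: inc_induct)
  case base
  then show ?case using B by auto
next
  case (step k)
  have BS: "B \<in> S" using A B by auto
  have D_pos: "D > 0"
    using D by (smt (verit) sum_nonneg abs_ge_zero mult_nonneg_nonneg)
  from step.IH obtain C where C: "C \<in> A"
    "\<And>j. j \<in> {Suc k<..m} \<Longrightarrow> 4 * D * real j < C (j, 1) \<and> C (j, 1) < 4 * D * real j + D"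
    "\<And>j t. t \<noteq> 1 \<or> j \<le> Suc k \<Longrightarrow> C (j, t) = B (j, t)" by blast
  have Sk: "Suc k \<in> {1..m}" "1 \<in> {1..p}" using step.hyps p by auto
  obtain v where v: "4 * D * real (Suc k) < v" "v < 4 * D * real (Suc k) + D"
    "C((Suc k, 1) := v) \<in> S \<longrightarrow> C((Suc k, 1) := v) \<in> A"
    by (rule AE_lborel_interval_witness[OF _ stays[OF C(1) Sk],
      of "4 * D * real (Suc k)" "4 * D * real (Suc k) + D"]) (use D_pos in auto)
  have "C((Suc k, 1) := v) \<in> S"
  proof (rule separated_in_S[OF _ _ D, of _ k B])
    show "C((Suc k, 1) := v) \<in> space L"
      using C(1) A S_space upd_space[OF Sk] by blast
    show "4 * D * real j < (C((Suc k, 1) := v)) (j, 1) \<and> (C((Suc k, 1) := v)) (j, 1) < 4 * D * real j + D"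
      if "j \<in> {k<..m}" for j
      using that v C(2)[of j] by (cases "j = Suc k") auto
    show "\<bar>(C((Suc k, 1) := v)) (j, t)\<bar> \<le> R" if "j \<in> {k<..m}" "t \<in> {2..p}" for j t
      using that C(3)[of t j] R[of j t] by auto
    show "(C((Suc k, 1) := v)) (j, t) = B (j, t)" if "j \<in> {1..k}" "t \<in> {1..p}" for j t
      using that C(3)[of t j] by auto
    show "\<bar>B (j, t)\<bar> \<le> R" if "j \<in> {1..k}" "t \<in> {1..p}" for j t
      using that R step.hyps by auto
  qed (use step.hyps BS in auto)
  then have "C((Suc k, 1) := v) \<in> A" using v(3) by blast
  then show ?case
    using v C(2,3) by (intro bexI[of _ "C((Suc k, 1) := v)"]) (auto simp: less_Suc_eq_le le_Suc_eq Suc_le_eq not_le)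
qed

text \<open>The raised state \<open>C\<close> must be chosen before the random target
  \<open>w\<close>, and its separation has to outweigh the entries of \<open>w\<close>. Therefore
  the targets are bounded by a constant \<open>Q\<close> given in advance.\<close>

lemma AE_bounded_in_A:
  assumes B: "B \<in> A" and Q: "0 \<le> Q"
  shows "AE w in L. w \<in> S \<and> (\<forall>j\<in>{1..m}. \<forall>t\<in>{1..p}. \<bar>w (j, t)\<bar> \<le> Q) \<longrightarrow> w \<in> A"
proof -
  interpret product_sigma_finite "\<lambda>_ :: nat \<times> nat. lborel :: real measure"
    by (simp add: product_sigma_finite_def sigma_finite_lborel)
  let ?I = "{1..m} \<times> {1..p}"
  \<comment> \<open>Bounds the entries of the starting state and of all targets, hence the slopes of
    every state on the path, where old and new slopes are mixed.\<close>
  define R where "R = Q + (\<Sum>c\<in>?I. \<bar>B c\<bar>)"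
  have R_nonneg: "0 \<le> R" and QR: "Q \<le> R" using Q by (auto simp: R_def intro!: add_nonneg_nonneg sum_nonneg)
  have R: "\<bar>B (j, t)\<bar> \<le> R" if "j \<in> {1..m}" "t \<in> {1..p}" for j t
    using member_le_sum[of "(j, t)" ?I "\<lambda>c. \<bar>B c\<bar>"] that Q by (auto simp: R_def)
  define D where "D = (\<Sum>i\<in>{1..n}. \<Sum>t\<in>{1..p}. \<bar>x i t\<bar>) * R + 1"
  have D: "(\<Sum>i\<in>{1..n}. \<Sum>t\<in>{1..p}. \<bar>x i t\<bar>) * R < D" by (simp add: D_def)
  obtain C where C: "C \<in> A"
    "\<And>j. j \<in> {0<..m} \<Longrightarrow> 4 * D * real j < C (j, 1) \<and> C (j, 1) < 4 * D * real j + D"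
    "\<And>j t. t \<noteq> 1 \<Longrightarrow> C (j, t) = B (j, t)"
    using raise_intercepts[OF B D R_nonneg R, of 0] by auto
  have C_space: "C \<in> space L" using C(1) A S_space by blast
  obtain slopes where slopes: "set slopes = {1..m} \<times> {2..p}" "distinct slopes"
    using finite_distinct_list[of "{1..m} \<times> {2..p}"] by auto
  \<comment> \<open>The order of the slopes is irrelevant; the intercepts follow in increasing order
    of \<open>j\<close>, so a lowered plane lands above planes that are already final and below
    those still raised.\<close>
  define cs where "cs = slopes @ map (\<lambda>j. (j, 1)) [1..<m + 1]"
  have set_cs: "set cs = ?I" using slopes(1) p by (auto simp: cs_def image_iff)
  have distinct: "distinct cs" using slopes by (auto simp: cs_def distinct_map inj_on_def)
  \<comment> \<open>A prefix consists of some slopes only (\<open>k = 0\<close>) or of all slopes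
    and the first \<open>k\<close> intercepts. So the planes up to \<open>k\<close> are final and
    those beyond \<open>k\<close> still have raised intercepts.\<close>
  have prefix: "\<exists>k\<le>m. \<exists>J. set (take r cs) = J \<union> (\<lambda>j. (j, 1)) ` {1..k} \<and> J \<subseteq> {1..m} \<times> {2..p} \<and>
      (k > 0 \<longrightarrow> J = {1..m} \<times> {2..p})" if "r \<le> length cs" for r
  proof (cases "r \<le> length slopes")
    case True
    then show ?thesis
      using slopes(1) set_take_subset[of r slopes]
      by (intro exI[of _ 0] conjI exI[of _ "set (take r slopes)"]) (auto simp: cs_def)
  next
    case False
    then have "take (r - length slopes) [1..<m + 1] = [1..<r - length slopes + 1]"
      using that by (subst take_upt) (auto simp: cs_def simp del: upt_Suc)
    then have "set (take r cs) = {1..m} \<times> {2..p} \<union> (\<lambda>j. (j, 1)) ` {1..r - length slopes}"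
      using False slopes(1) by (simp add: cs_def take_map atLeastLessThanSuc_atLeastAtMost del: upt_Suc)
    then show ?thesis
      using that False by (intro exI[of _ "r - length slopes"] conjI exI[of _ "{1..m} \<times> {2..p}"])
        (auto simp: cs_def simp del: upt_Suc)
  qed
  have "AE w in PiM ?I (\<lambda>_. lborel). (\<forall>k\<le>length cs. override_on C w (set (take k cs)) \<in> S) \<longrightarrow> override_on C w (set cs) \<in> A"
    using A(1) S_sets C(1) stays distinct set_cs
    by (intro AE_override_on) (auto simp: coef_space_def)
  then have "AE w in L. (\<forall>k\<le>length cs. override_on C w (set (take k cs)) \<in> S) \<longrightarrow> override_on C w ?I \<in> A"
    by (simp only: coef_space_def set_cs)
  then show ?thesis
    using AE_space
  proof eventually_elim
    fix w
    assume reach: "(\<forall>k\<le>length cs. override_on C w (set (take k cs)) \<in> S) \<longrightarrow> override_on C w ?I \<in> A"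
      and w: "w \<in> space L"
    show "w \<in> S \<and> (\<forall>j\<in>{1..m}. \<forall>t\<in>{1..p}. \<bar>w (j, t)\<bar> \<le> Q) \<longrightarrow> w \<in> A"
    proof
      assume wS: "w \<in> S \<and> (\<forall>j\<in>{1..m}. \<forall>t\<in>{1..p}. \<bar>w (j, t)\<bar> \<le> Q)"
      have "override_on C w (set (take r cs)) \<in> S" if r: "r \<le> length cs" for r
      proof -
        obtain k J where k: "k \<le> m" and J: "set (take r cs) = J \<union> (\<lambda>j. (j, 1)) ` {1..k}"
          "J \<subseteq> {1..m} \<times> {2..p}" "k > 0 \<Longrightarrow> J = {1..m} \<times> {2..p}"
          using prefix[OF r] by blast
        let ?C = "override_on C w (set (take r cs))"
        show ?thesis
        \<comment> \<open>Here the low planes are those of the target \<open>w\<close>, whereas on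
          the way up they were those of the starting state.\<close>
        proof (rule separated_in_S[OF _ k D R_nonneg, of _ w])
          show "?C \<in> space L"
            using C_space w set_take_subset[of r cs] set_cs
            by (fastforce simp: coef_space_def space_PiM PiE_iff extensional_def override_on_def)
          show "4 * D * real j < ?C (j, 1) \<and> ?C (j, 1) < 4 * D * real j + D" if "j \<in> {k<..m}" for j
          proof -
            have "(j, 1) \<notin> set (take r cs)" using J that by auto
            then show ?thesis using C(2)[of j] that by (simp add: override_on_def)
          qed
          show "\<bar>?C (j, t)\<bar> \<le> R" if "j \<in> {k<..m}" "t \<in> {2..p}" for j t
          proof -
            have jt: "j \<in> {1..m}" "t \<in> {1..p}" "t \<noteq> 1" using that by auto
            have "\<bar>w (j, t)\<bar> \<le> R" using wS QR jt by force
            then show ?thesis using C(3)[OF jt(3)] R[OF jt(1,2)] by (simp add: override_on_def)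
          qed
          show "?C (j, t) = w (j, t)" if "j \<in> {1..k}" "t \<in> {1..p}" for j t
          proof -
            have "(j, t) \<in> set (take r cs)" using J that k by (cases "t = 1") auto
            then show ?thesis by (simp add: override_on_def)
          qed
          show "\<bar>w (j, t)\<bar> \<le> R" if "j \<in> {1..k}" "t \<in> {1..p}" for j t
            using wS QR that k by force
        qed (use wS in auto)
      qed
      moreover have "override_on C w ?I = w"
        using C_space w by (auto simp: override_on_def coef_space_def space_PiM PiE_iff extensional_def fun_eq_iff)
      ultimately show "w \<in> A" using reach by auto
    qed
  qed
qed

text \<open>Every target is bounded by some natural number, and countably many null sets form a null
  set.\<close>

lemma AE_in_A:
  assumes "A \<noteq> {}"
  shows "AE w in L. w \<in> S \<longrightarrow> w \<in> A"
proof -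
  obtain B where B: "B \<in> A" using assms by blast
  have "AE w in L. \<forall>q :: nat. w \<in> S \<and> (\<forall>j\<in>{1..m}. \<forall>t\<in>{1..p}. \<bar>w (j, t)\<bar> \<le> real q) \<longrightarrow> w \<in> A"
    by (subst AE_all_countable) (intro allI AE_bounded_in_A[OF B], simp)
  then show ?thesis
  proof eventually_elim
    fix w
    assume *: "\<forall>q :: nat. w \<in> S \<and> (\<forall>j\<in>{1..m}. \<forall>t\<in>{1..p}. \<bar>w (j, t)\<bar> \<le> real q) \<longrightarrow> w \<in> A"
    obtain q :: nat where q: "(\<Sum>c\<in>{1..m} \<times> {1..p}. \<bar>w c\<bar>) \<le> real q"
      using real_arch_simple by blast
    have "\<bar>w (j, t)\<bar> \<le> real q" if "j \<in> {1..m}" "t \<in> {1..p}" for j t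
      using member_le_sum[of "(j, t)" "{1..m} \<times> {1..p}" "\<lambda>c. \<bar>w c\<bar>"] that q by auto
    then show "w \<in> S \<longrightarrow> w \<in> A" using * by blast
  qed
qed

end

text \<open>Two absorbing sets each contain almost all of \<open>S\<close>; were they disjoint,
  \<open>S\<close> would be null.\<close>

lemma stationary_unique:
  assumes "stationary_distribution (state_space n p m x) kern N"
    and "stationary_distribution (state_space n p m x) kern P"
    and not_null: "\<not> (AE w in L. w \<notin> S)"
  shows "N = P"
proof (rule stationary_distribution_unique[OF assms(1,2)])
  fix A A'
  assume A: "A \<in> sets (state_space n p m x)" "A \<noteq> {}" "\<And>B. B \<in> A \<Longrightarrow> measure (kern B) A = 1"
    and A': "A' \<in> sets (state_space n p m x)" "A' \<noteq> {}" "\<And>B. B \<in> A' \<Longrightarrow> measure (kern B) A' = 1"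
  have "AE w in L. w \<in> S \<longrightarrow> w \<in> A"
    using A by (intro AE_in_A absorbing_fun_upd) (auto simp: sets_state_space_iff)
  moreover have "AE w in L. w \<in> S \<longrightarrow> w \<in> A'"
    using A' by (intro AE_in_A absorbing_fun_upd) (auto simp: sets_state_space_iff)
  ultimately have "AE w in L. w \<notin> S" if "A \<inter> A' = {}"
    by eventually_elim (use that in auto)
  then show "A \<inter> A' \<noteq> {}" using not_null by blast
qed

end

theorem theorem3p1:
  fixes n p m :: nat
    and x :: "nat \<Rightarrow> nat \<Rightarrow> real" and y :: "nat \<Rightarrow> real"
    and \<tau> :: "nat \<Rightarrow> real" and \<sigma> :: real
    and prior :: "coef \<Rightarrow> real"
    and loc spread :: "nat \<Rightarrow> nat \<Rightarrow> coef \<Rightarrow> real"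
  assumes "n \<ge> 1" and "p \<ge> 1" and "m \<ge> 1"
    and "\<forall>i\<in>{1..n}. x i 1 = 1"
    and "0 < \<tau> 1" and "strict_mono_on {1..m} \<tau>" and "\<tau> m < 1"
    and "\<sigma> > 0"
    and "prior \<in> borel_measurable (coef_space p m)"
    and "\<forall>B\<in>space (coef_space p m). 0 \<le> prior B"
    and "\<forall>B\<in>space (coef_space p m). B \<notin> monotone_set n p m x \<longrightarrow> prior B = 0"
    and "(\<integral>\<^sup>+B. ennreal (prior B) \<partial>coef_space p m) = 1"
    and "integrable (coef_space p m) (\<lambda>B. prior B * lid_likelihood n p m x y \<tau> \<sigma> B)"
    and "evidence n p m x y \<tau> \<sigma> prior > 0"
    and "\<forall>j\<in>{1..m}. \<forall>l\<in>{1..p}. loc j l \<in> borel_measurable (coef_space p m)"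
    and "\<forall>j\<in>{1..m}. \<forall>l\<in>{1..p}. spread j l \<in> borel_measurable (coef_space p m)"
    and "\<forall>j\<in>{1..m}. \<forall>l\<in>{1..p}. \<forall>B\<in>monotone_set n p m x. spread j l B > 0"
  shows "stationary_distribution (state_space n p m x)
           (lid_kernel n p m x y \<tau> \<sigma> prior loc spread) (posterior n p m x y \<tau> \<sigma> prior)
       \<and> ((\<forall>B\<in>monotone_set n p m x. prior B > 0) \<longrightarrow>
            (\<forall>N. stationary_distribution (state_space n p m x)
                   (lid_kernel n p m x y \<tau> \<sigma> prior loc spread) N
                 \<longrightarrow> N = posterior n p m x y \<tau> \<sigma> prior))"
proof -
  interpret lid_chain n p m x y \<tau> \<sigma> prior loc spread
    using assms by unfold_locales auto
  have stationary: "stationary_distribution (state_space n p m x) kern (posterior n p m x y \<tau> \<sigma> prior)"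
    using assms by (intro posterior_stationary) auto
  moreover have "N = posterior n p m x y \<tau> \<sigma> prior"
    if pos: "\<forall>B\<in>S. prior B > 0" and N: "stationary_distribution (state_space n p m x) kern N" for N
  proof -
    interpret lid_chain_pos n p m x y \<tau> \<sigma> prior loc spread
      using assms(4) pos by unfold_locales auto
    show ?thesis
    proof (rule stationary_unique[OF N stationary])
      \<comment> \<open>The prior vanishes outside \<open>S\<close> and has total mass 1, so
        \<open>S\<close> cannot be null.\<close>
      show "\<not> (AE B in L. B \<notin> S)"
      proof
        assume "AE B in L. B \<notin> S"
        then have "AE B in L. ennreal (prior B) = 0"
          using AE_space by eventually_elim (simp add: prior_outside)
        then have "(\<integral>\<^sup>+B. ennreal (prior B) \<partial>L) = 0"
          by (subst nn_integral_0_iff_AE) auto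
        then show False using assms(12) by simp
      qed
    qed
  qed
  ultimately show ?thesis by blast
qed

end
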